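(* Let $n\ge 0$ and let $\phi:\mathrm{Pauli}(n)\to\mathrm{Pauli}(n)$ be a group automorphism of the $n$-qubit Pauli group that fixes scalars (i.e. $\phi(\lambda I)=\lambda I$ for all $\lambda\in\{\pm1,\pm i\}$). Then there exists an $n$-qubit Clifford circuit $C$ in normal form such that $C\bullet P=\phi(P)$ for all $P\in\mathrm{Pauli}(n)$. Moreover, the normal form $C$ is unique up to the scalar $\omega^p$; that is, any two normal circuits with this property have the same parameters, except possibly for the exponent $p$ of the scalar $\omega^p$.
   Context: Matrices: $\omega=e^{i\pi/4}$ (a $0$-qubit operator, i.e. a scalar), $H=\frac1{\sqrt2}\begin{pmatrix}1&1\\1&-1\end{pmatrix}$, $S=\mathrm{diag}(1,i)$, $Z_c=\mathrm{diag}(1,1,1,-1)$; $X,Y,Z$ are the usual Pauli matrices. $\mathrm{Clifford}(n)$ is the group of $2^n\times 2^n$ unitary matrices obtained from $\omega,H,S,Z_c$ and identities by composition and tensor product. $\mathrm{Pauli}(n)$ is the group of matrices $\lambda P_1\otimes\cdots\otimes P_n$ with $\lambda\in\{\pm1,\pm i\}$ and $P_1,\dots,P_n\in\{I,X,Y,Z\}$. For a Clifford operator $C$ and a Pauli operator $P$, $C\bullet P:=CPC^{-1}\in \mathrm{Pauli}(n)$. Circuits are written in order of application (the leftmost gate is applied first). Qubits are numbered $1,2,\dots$ from top to bottom; the first tensor factor is qubit 1. A subscript $q$ on $h,s$ means $H$, $S$ applied to qubit $q$, and $z$ denotes $Z_c$ on qubits $1,2$. Define the following named gates. One-qubit: $A_1=$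 identity, $A_2=H$, $A_3=H\,S\,H$; $C_1=$ identity, $C_2=H\,S\,S\,H$; $E_1=$ identity, $E_2=S$, $E_3=S^2$, $E_4=S^3$. Two-qubit: $B_1=h_2\,z\,h_1h_2\,z\,h_1h_2\,z$, $B_2=z\,h_1h_2\,z$, $B_3=h_1s_1\,z\,h_1h_2\,z$, $B_4=h_1\,z\,h_1h_2\,z$; $D_1=z\,h_1h_2\,z\,h_1h_2\,z\,h_2$, $D_2=h_1\,z\,h_1h_2\,z\,h_2$, $D_3=h_1h_2s_2\,z\,h_1h_2\,z\,h_2$, $D_4=h_1h_2\,z\,h_1h_2\,z\,h_2$. An $n$-qubit circuit ($n\ge1$) is $Z$-normal if, for some $1\le m\le n$, it consists of (in order of application): $A_i$ on qubit $m$, then $B_{j_1}$ on qubits $(m-1,m)$, $B_{j_2}$ on qubits $(m-2,m-1)$, …, $B_{j_{m-1}}$ on qubits $(1,2)$, then $C_k$ on qubit $1$, where $i\in\{1,2,3\}$, $j_1,\dots,j_{m-1}\in\{1,2,3,4\}$, $k\in\{1,2\}$. It is $X$-normal if it consists of: $D_{\ell_1}$ on qubits $(1,2)$, $D_{\ell_2}$ on qubits $(2,3)$, …, $D_{\ell_{n-1}}$ on qubits $(n-1,n)$, then $E_h$ on qubit $n$, where $\ell_1,\dots,\ell_{n-1},h\in\{1,2,3,4\}$. An $n$-qubit circuit ($n\geq 0$) is normal (in normal form) if it is of the form $$L^{(n)}M^{(n)}\,L^{(n-1)}M^{(n-1)}\cdots L^{(2)}M^{(2)}\,L^{(1)}M^{(1)}\cdot\omega^p$$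 (in order of application), where $p\in\{0,\dots,7\}$, $L^{(r)}$ is a $Z$-normal and $M^{(r)}$ an $X$-normal $r$-qubit circuit, acting on the top $r$ qubits $1,\dots,r$. $Z$-normal, $X$-normal and normal circuits are syntactic objects determined by their parameters ($m,i,j_\bullet,k$ for each $L^{(r)}$; $\ell_\bullet,h$ for each $M^{(r)}$; and $p$); each also denotes a Clifford operator. *)

theory Defs
  imports
    "HOL-Algebra.Group"
    "Jordan_Normal_Form.Gauss_Jordan_Elimination"
    Complex_Main
begin

text \<open>Kronecker product; the first factor is the most significant one.\<close>

definition tensor_mat :: "complex mat \<Rightarrow> complex mat \<Rightarrow> complex mat" where
  "tensor_mat A B = mat (dim_row A * dim_row B) (dim_col A * dim_col B)
     (\<lambda>(i, j). A $$ (i div dim_row B, j div dim_col B) * B $$ (i mod dim_row B, j mod dim_col B))"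

definition tensor_list :: "complex mat list \<Rightarrow> complex mat" where
  "tensor_list As = foldr tensor_mat As (1\<^sub>m 1)"

definition omega :: complex where
  "omega = exp (\<i> * complex_of_real (pi / 4))"

definition H_mat :: "complex mat" where
  "H_mat = complex_of_real (1 / sqrt 2) \<cdot>\<^sub>m mat_of_rows_list 2 [[1, 1], [1, -1]]"

definition S_mat :: "complex mat" where
  "S_mat = mat_of_rows_list 2 [[1, 0], [0, \<i>]]"

definition Zc_mat :: "complex mat" where
  "Zc_mat = mat_of_rows_list 4 [[1, 0, 0, 0], [0, 1, 0, 0], [0, 0, 1, 0], [0, 0, 0, -1]]"

definition X_mat :: "complex mat" where
  "X_mat = mat_of_rows_list 2 [[0, 1], [1, 0]]"

definition Y_mat :: "complex mat" where
  "Y_mat = mat_of_rows_list 2 [[0, -\<i>], [\<i>, 0]]"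

definition Z_mat :: "complex mat" where
  "Z_mat = mat_of_rows_list 2 [[1, 0], [0, -1]]"

definition pauli_scalars :: "complex set" where
  "pauli_scalars = {1, -1, \<i>, -\<i>}"

definition pauli_group :: "nat \<Rightarrow> complex mat monoid" where
  "pauli_group n =
     \<lparr>carrier = {c \<cdot>\<^sub>m tensor_list Ps | c Ps. c \<in> pauli_scalars \<and> length Ps = n \<and>
                   set Ps \<subseteq> {1\<^sub>m 2, X_mat, Y_mat, Z_mat}},
      mult = (*), one = 1\<^sub>m (2 ^ n)\<rparr>"

text \<open>
  Closure under inverses is automatic, as the generators have finite order.
\<close>

inductive_set clifford :: "(nat \<times> complex mat) set" where
  omega: "(0, omega \<cdot>\<^sub>m 1\<^sub>m 1) \<in> clifford"
| H: "(1, H_mat) \<in> clifford"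
| S: "(1, S_mat) \<in> clifford"
| Zc: "(2, Zc_mat) \<in> clifford"
| ident: "(n, 1\<^sub>m (2 ^ n)) \<in> clifford"
| comp: "(n, A) \<in> clifford \<Longrightarrow> (n, B) \<in> clifford \<Longrightarrow> (n, A * B) \<in> clifford"
| tensor: "(m, A) \<in> clifford \<Longrightarrow> (n, B) \<in> clifford \<Longrightarrow> (m + n, tensor_mat A B) \<in> clifford"

definition Clifford :: "nat \<Rightarrow> complex mat set" where
  "Clifford n = {A. (n, A) \<in> clifford}"

definition conj_act :: "complex mat \<Rightarrow> complex mat \<Rightarrow> complex mat" (infixl "\<bullet>\<^sub>C" 70) where
  "C \<bullet>\<^sub>C P = C * P * the (mat_inverse C)"

text \<open>
  A circuit is a list of gates, the first gate being applied first. Qubits are numbered from 1;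
  \<open>CZ q\<close> is the controlled-Z gate on qubits \<open>q\<close> and \<open>q + 1\<close>, and \<open>Omega\<close> is the global scalar.
\<close>

datatype gate = Had nat | Phase nat | CZ nat | Omega

fun gate_op :: "nat \<Rightarrow> gate \<Rightarrow> complex mat" where
  "gate_op n (Had q) = tensor_mat (1\<^sub>m (2 ^ (q - 1))) (tensor_mat H_mat (1\<^sub>m (2 ^ (n - q))))"
| "gate_op n (Phase q) = tensor_mat (1\<^sub>m (2 ^ (q - 1))) (tensor_mat S_mat (1\<^sub>m (2 ^ (n - q))))"
| "gate_op n (CZ q) = tensor_mat (1\<^sub>m (2 ^ (q - 1))) (tensor_mat Zc_mat (1\<^sub>m (2 ^ (n - (q + 1)))))"
| "gate_op n Omega = omega \<cdot>\<^sub>m 1\<^sub>m (2 ^ n)"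

fun circuit_op :: "nat \<Rightarrow> gate list \<Rightarrow> complex mat" where
  "circuit_op n [] = 1\<^sub>m (2 ^ n)"
| "circuit_op n (g # gs) = circuit_op n gs * gate_op n g"

text \<open>
  The named gates, as circuits on qubit 1 or on qubits 1 and 2; \<open>at_qubit q\<close> moves such a
  circuit to qubit \<open>q\<close>, respectively to qubits \<open>q\<close> and \<open>q + 1\<close>.
\<close>

fun shift_gate :: "nat \<Rightarrow> gate \<Rightarrow> gate" where
  "shift_gate k (Had q) = Had (q + k)"
| "shift_gate k (Phase q) = Phase (q + k)"
| "shift_gate k (CZ q) = CZ (q + k)"
| "shift_gate k Omega = Omega"

definition at_qubit :: "nat \<Rightarrow> gate list \<Rightarrow> gate list" where
  "at_qubit q gs = map (shift_gate (q - 1)) gs"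

datatype A_index = A1 | A2 | A3
datatype B_index = B1 | B2 | B3 | B4
datatype C_index = C1 | C2
datatype D_index = D1 | D2 | D3 | D4
datatype E_index = E1 | E2 | E3 | E4

fun A_circ :: "A_index \<Rightarrow> gate list" where
  "A_circ A1 = []"
| "A_circ A2 = [Had 1]"
| "A_circ A3 = [Had 1, Phase 1, Had 1]"

fun B_circ :: "B_index \<Rightarrow> gate list" where
  "B_circ B1 = [Had 2, CZ 1, Had 1, Had 2, CZ 1, Had 1, Had 2, CZ 1]"
| "B_circ B2 = [CZ 1, Had 1, Had 2, CZ 1]"
| "B_circ B3 = [Had 1, Phase 1, CZ 1, Had 1, Had 2, CZ 1]"
| "B_circ B4 = [Had 1, CZ 1, Had 1, Had 2, CZ 1]"

fun C_circ :: "C_index \<Rightarrow> gate list" where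
  "C_circ C1 = []"
| "C_circ C2 = [Had 1, Phase 1, Phase 1, Had 1]"

fun D_circ :: "D_index \<Rightarrow> gate list" where
  "D_circ D1 = [CZ 1, Had 1, Had 2, CZ 1, Had 1, Had 2, CZ 1, Had 2]"
| "D_circ D2 = [Had 1, CZ 1, Had 1, Had 2, CZ 1, Had 2]"
| "D_circ D3 = [Had 1, Had 2, Phase 2, CZ 1, Had 1, Had 2, CZ 1, Had 2]"
| "D_circ D4 = [Had 1, Had 2, CZ 1, Had 1, Had 2, CZ 1, Had 2]"

fun E_circ :: "E_index \<Rightarrow> gate list" where
  "E_circ E1 = []"
| "E_circ E2 = [Phase 1]"
| "E_circ E3 = [Phase 1, Phase 1]"
| "E_circ E4 = [Phase 1, Phase 1, Phase 1]"

text \<open>Parameters of a Z-normal circuit: \<open>m\<close>, \<open>i\<close>, \<open>[j\<^sub>1, \<dots>, j\<^bsub>m-1\<^esub>]\<close> and \<open>k\<close>.\<close>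

datatype Z_params = Z_params (Zm: nat) (Zi: A_index) (Zj: "B_index list") (Zk: C_index)

definition Z_normal :: "nat \<Rightarrow> Z_params \<Rightarrow> bool" where
  "Z_normal n L \<longleftrightarrow> 1 \<le> Zm L \<and> Zm L \<le> n \<and> length (Zj L) = Zm L - 1"

definition Z_circ :: "Z_params \<Rightarrow> gate list" where
  "Z_circ L =
     at_qubit (Zm L) (A_circ (Zi L)) @
     concat (map (\<lambda>t. at_qubit (Zm L - t) (B_circ (Zj L ! (t - 1)))) [1..<Zm L]) @
     at_qubit 1 (C_circ (Zk L))"

text \<open>Parameters of an X-normal circuit on \<open>n\<close> qubits: \<open>[\<ell>\<^sub>1, \<dots>, \<ell>\<^bsub>n-1\<^esub>]\<close> and \<open>h\<close>.\<close>

datatype X_params = X_params (Xl: "D_index list") (Xh: E_index)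

definition X_normal :: "nat \<Rightarrow> X_params \<Rightarrow> bool" where
  "X_normal n M \<longleftrightarrow> 1 \<le> n \<and> length (Xl M) = n - 1"

definition X_circ :: "nat \<Rightarrow> X_params \<Rightarrow> gate list" where
  "X_circ n M =
     concat (map (\<lambda>t. at_qubit t (D_circ (Xl M ! (t - 1)))) [1..<n]) @
     at_qubit n (E_circ (Xh M))"

text \<open>
  The layers of a normal circuit are listed in order of application, so for \<open>n\<close> qubits the
  entry at (zero-based) position \<open>t\<close> is the pair of parameters of \<open>L\<close> and \<open>M\<close> for
  \<open>r = n - t\<close> qubits.
\<close>

datatype normal_circuit =
  Normal_circuit (layers: "(Z_params \<times> X_params) list") (phase_exp: nat)

definition is_normal :: "nat \<Rightarrow> normal_circuit \<Rightarrow> bool" where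
  "is_normal n C \<longleftrightarrow> length (layers C) = n \<and> phase_exp C < 8 \<and>
     (\<forall>t<n. Z_normal (n - t) (fst (layers C ! t)) \<and> X_normal (n - t) (snd (layers C ! t)))"

definition normal_circ :: "nat \<Rightarrow> normal_circuit \<Rightarrow> gate list" where
  "normal_circ n C =
     concat (map (\<lambda>t. Z_circ (fst (layers C ! t)) @ X_circ (n - t) (snd (layers C ! t))) [0..<n]) @
     replicate (phase_exp C) Omega"

definition normal_op :: "nat \<Rightarrow> normal_circuit \<Rightarrow> complex mat" where
  "normal_op n C = circuit_op n (normal_circ n C)"

end

theory Submission imports Defs begin

text \<open>
  Conjugation by a gate acts on Pauli words, so everything happens on signed lists of Pauli letters.
  Each Z-normal circuit sends exactly one word to \<open>Z \<otimes> I \<otimes> \<dots> \<otimes> I\<close>, and its parameters can be read off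
  that word: its last letter other than \<open>I\<close>, the letters before it, and the sign. The
  preimages obtained are precisely the words \<open>P\<close> with \<open>P\<^sup>2 = I\<close> and \<open>P \<noteq> \<plusminus>I\<close>. In the same way an X-normal
  circuit sends \<open>Z \<otimes> I \<otimes> \<dots> \<otimes> I\<close> to \<open>I \<otimes> \<dots> \<otimes> I \<otimes> Z\<close>, and is determined by the preimage of
  \<open>I \<otimes> \<dots> \<otimes> I \<otimes> X\<close>, which can be any self-inverse word that anticommutes with \<open>Z \<otimes> I \<otimes> \<dots> \<otimes> I\<close>. Hence the first layer
  \<open>L M\<close> is the unique one mapping \<open>\<phi>\<^sup>-\<^sup>1(Z\<^sub>n)\<close> and \<open>\<phi>\<^sup>-\<^sup>1(X\<^sub>n)\<close> to \<open>Z\<^sub>n\<close> and \<open>X\<^sub>n\<close>. After composing with its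
  inverse, \<open>\<phi>\<close> fixes both, so it preserves their commutant, the Pauli group on \<open>n - 1\<close> qubits.
\<close>

subsection \<open>Kronecker products\<close>

lemma tensor_mat_dim [simp]:
  "dim_row (tensor_mat A B) = dim_row A * dim_row B"
  "dim_col (tensor_mat A B) = dim_col A * dim_col B"
  by (simp_all add: tensor_mat_def)

lemma tensor_mat_carrier [intro, simp]:
  "A \<in> carrier_mat a b \<Longrightarrow> B \<in> carrier_mat c d \<Longrightarrow> tensor_mat A B \<in> carrier_mat (a * c) (b * d)"
  by (metis carrier_matD carrier_matI tensor_mat_dim)

lemma tensor_mat_index:
  "i < dim_row A * dim_row B \<Longrightarrow> j < dim_col A * dim_col B \<Longrightarrow>
   tensor_mat A B $$ (i, j) =
     A $$ (i div dim_row B, j div dim_col B) * B $$ (i mod dim_row B, j mod dim_col B)"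
  by (simp add: tensor_mat_def)

lemma div_mod_less_prod:
  fixes i a b :: nat
  assumes "i < a * b"
  shows "i div b < a" "i mod b < b" "0 < b"
proof -
  show "0 < b" using assms by (cases b) auto
  then show "i mod b < b" by simp
  show "i div b < a" using assms by (simp add: less_mult_imp_div_less)
qed

text \<open>Division with remainder identifies an index below \<open>a * b\<close> with a pair of
  indices. This splits the inner products in a product of Kronecker products into double sums that
  factor.\<close>

lemma sum_div_mod:
  fixes f :: "nat \<Rightarrow> nat \<Rightarrow> complex"
  shows "(\<Sum>k<a * b. f (k div b) (k mod b)) = (\<Sum>x<a. \<Sum>y<b. f x y)"
proof -
  have "(\<Sum>x<a. \<Sum>y<b. f x y) = (\<Sum>(x, y)\<in>{..<a} \<times> {..<b}. f x y)"
    by (simp add: sum.cartesian_product)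
  also have "\<dots> = (\<Sum>k<a * b. f (k div b) (k mod b))"
  proof (rule sum.reindex_bij_witness[where j = "\<lambda>(x, y). x * b + y" and i = "\<lambda>k. (k div b, k mod b)"])
    fix p assume "p \<in> {..<a} \<times> {..<b}"
    then obtain x y where p: "p = (x, y)" "x < a" "y < b" by auto
    have "x * b + y < Suc x * b" using p by simp
    also have "\<dots> \<le> a * b" using p by (intro mult_right_mono) auto
    finally show "(case p of (x, y) \<Rightarrow> x * b + y) \<in> {..<a * b}" using p by simp
  qed (auto simp: div_mod_less_prod)
  finally show ?thesis by simp
qed

lemma tensor_mat_mult:
  assumes A: "A \<in> carrier_mat a b" and B: "B \<in> carrier_mat c d"
    and C: "C \<in> carrier_mat b e" and D: "D \<in> carrier_mat d f"
  shows "tensor_mat A B * tensor_mat C D = tensor_mat (A * C) (B * D)"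
proof (rule eq_matI)
  fix i j
  assume "i < dim_row (tensor_mat (A * C) (B * D))" "j < dim_col (tensor_mat (A * C) (B * D))"
  then have i: "i < a * c" and j: "j < e * f" using A B C D by auto
  note ij = div_mod_less_prod[OF i] div_mod_less_prod[OF j]
  have "(tensor_mat A B * tensor_mat C D) $$ (i, j) =
      (\<Sum>k<b * d. tensor_mat A B $$ (i, k) * tensor_mat C D $$ (k, j))"
    using A B C D i j by (simp add: scalar_prod_def atLeast0LessThan)
  also have "\<dots> = (\<Sum>k<b * d. (A $$ (i div c, k div d) * B $$ (i mod c, k mod d)) *
      (C $$ (k div d, j div f) * D $$ (k mod d, j mod f)))"
    using A B C D i j by (intro sum.cong) (auto simp: tensor_mat_index)
  also have "\<dots> = (\<Sum>x<b. \<Sum>y<d. (A $$ (i div c, x) * B $$ (i mod c, y)) *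
      (C $$ (x, j div f) * D $$ (y, j mod f)))"
    by (rule sum_div_mod)
  also have "\<dots> = (\<Sum>x<b. A $$ (i div c, x) * C $$ (x, j div f)) *
      (\<Sum>y<d. B $$ (i mod c, y) * D $$ (y, j mod f))"
    by (simp add: sum_product mult_ac)
  also have "\<dots> = (A * C) $$ (i div c, j div f) * (B * D) $$ (i mod c, j mod f)"
    using A B C D ij by (simp add: scalar_prod_def atLeast0LessThan)
  also have "\<dots> = tensor_mat (A * C) (B * D) $$ (i, j)"
    using A B C D i j by (simp add: tensor_mat_index)
  finally show "(tensor_mat A B * tensor_mat C D) $$ (i, j) = tensor_mat (A * C) (B * D) $$ (i, j)" .
qed (use A B C D in auto)

text \<open>Both bracketings of a triple Kronecker product read the same three mixed-radix digits
  off an index.\<close>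

lemma div_mod_mult_assoc:
  fixes i b c :: nat
  shows "i div (b * c) = i div c div b" "i mod (b * c) div c = i div c mod b"
    "i mod (b * c) mod c = i mod c"
  by (cases "c = 0"; simp add: mult.commute[of b c] div_mult2_eq mod_mult2_eq)+

lemma tensor_mat_assoc: "tensor_mat (tensor_mat A B) C = tensor_mat A (tensor_mat B C)"
proof (rule eq_matI)
  fix i j
  assume ij: "i < dim_row (tensor_mat A (tensor_mat B C))" "j < dim_col (tensor_mat A (tensor_mat B C))"
  then have i: "i < dim_row A * (dim_row B * dim_row C)" and j: "j < dim_col A * (dim_col B * dim_col C)"
    by auto
  have i': "i < dim_row A * dim_row B * dim_row C" and j': "j < dim_col A * dim_col B * dim_col C"
    using i j by (simp_all add: mult.assoc)
  show "tensor_mat (tensor_mat A B) C $$ (i, j) = tensor_mat A (tensor_mat B C) $$ (i, j)"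
    using div_mod_less_prod[OF i] div_mod_less_prod[OF j]
      div_mod_less_prod[OF i'] div_mod_less_prod[OF j'] i j i' j'
    by (simp add: tensor_mat_index div_mod_mult_assoc)
qed auto

lemma tensor_mat_smult:
  "tensor_mat (c \<cdot>\<^sub>m A) B = c \<cdot>\<^sub>m tensor_mat A B"
  "tensor_mat A (c \<cdot>\<^sub>m B) = c \<cdot>\<^sub>m tensor_mat A B"
  by (rule eq_matI; auto simp: tensor_mat_def div_mod_less_prod)+

lemma tensor_mat_one: "tensor_mat (1\<^sub>m a) (1\<^sub>m b) = 1\<^sub>m (a * b)"
proof (rule eq_matI)
  fix i j assume "i < dim_row (1\<^sub>m (a * b))" "j < dim_col (1\<^sub>m (a * b))"
  then have i: "i < a * b" and j: "j < a * b" by auto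
  have "i = j \<longleftrightarrow> i div b = j div b \<and> i mod b = j mod b"
    by (metis div_mult_mod_eq)
  then show "tensor_mat (1\<^sub>m a) (1\<^sub>m b) $$ (i, j) = (1\<^sub>m (a * b) :: complex mat) $$ (i, j)"
    using i j div_mod_less_prod[OF i] div_mod_less_prod[OF j] by (auto simp: tensor_mat_index)
qed auto

lemma tensor_mat_one_left [simp]: "tensor_mat (1\<^sub>m (Suc 0)) A = A"
  by (rule eq_matI) (auto simp: tensor_mat_def)

lemma tensor_mat_one_right [simp]: "tensor_mat A (1\<^sub>m (Suc 0)) = A"
  by (rule eq_matI) (auto simp: tensor_mat_def)

lemma prod_index_less:
  fixes i k :: nat
  assumes "i < a" "k < c"
  shows "i * c + k < a * c" "(i * c + k) div c = i" "(i * c + k) mod c = k"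
proof -
  have "i * c + k < Suc i * c" using assms by simp
  also have "\<dots> \<le> a * c" using assms by (intro mult_right_mono) auto
  finally show "i * c + k < a * c" .
qed (use assms in auto)

lemma tensor_mat_block_index:
  assumes "A \<in> carrier_mat a b" "B \<in> carrier_mat c d" "i < a" "j < b" "k < c" "l < d"
  shows "tensor_mat A B $$ (i * c + k, j * d + l) = A $$ (i, j) * B $$ (k, l)"
  using tensor_mat_index[of "i * c + k" A B "j * d + l"] assms(1,2)
    prod_index_less[OF assms(3,5)] prod_index_less[OF assms(4,6)]
  by (metis carrier_matD)

text \<open>A Kronecker product is a block matrix whose blocks are the entries of the first factor
  times the second factor. Comparing blocks is how letters are told apart in
  \<open>tensor_list_inj\<close>.\<close>

lemma tensor_mat_block:
  assumes eq: "tensor_mat A B = tensor_mat A' B'"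
    and A: "A \<in> carrier_mat a b" "A' \<in> carrier_mat a b"
    and B: "B \<in> carrier_mat c d" "B' \<in> carrier_mat c d" and ij: "i < a" "j < b"
  shows "A $$ (i, j) \<cdot>\<^sub>m B = A' $$ (i, j) \<cdot>\<^sub>m B'"
proof (rule eq_matI)
  fix k l assume "k < dim_row (A' $$ (i, j) \<cdot>\<^sub>m B')" "l < dim_col (A' $$ (i, j) \<cdot>\<^sub>m B')"
  then have kl: "k < c" "l < d" using B by auto
  have "A $$ (i, j) * B $$ (k, l) = A' $$ (i, j) * B' $$ (k, l)"
    using tensor_mat_block_index[OF A(1) B(1) ij kl] tensor_mat_block_index[OF A(2) B(2) ij kl]
    by (simp only: eq)
  then show "(A $$ (i, j) \<cdot>\<^sub>m B) $$ (k, l) = (A' $$ (i, j) \<cdot>\<^sub>m B') $$ (k, l)"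
    using B kl by simp
qed (use B in auto)

lemma smult_smult_mat: "c \<cdot>\<^sub>m (d \<cdot>\<^sub>m A) = (c * d :: complex) \<cdot>\<^sub>m A"
  by (rule eq_matI) (auto simp: mult.assoc)

lemma one_smult_mat [simp]: "1 \<cdot>\<^sub>m A = (A :: complex mat)"
  by (rule eq_matI) auto

lemma tensor_list_Nil [simp]: "tensor_list [] = 1\<^sub>m 1"
  and tensor_list_Cons [simp]: "tensor_list (A # As) = tensor_mat A (tensor_list As)"
  by (simp_all add: tensor_list_def)

lemma tensor_list_append: "tensor_list (As @ Bs) = tensor_mat (tensor_list As) (tensor_list Bs)"
  by (induction As) (simp_all add: tensor_mat_assoc)

subsection \<open>Pauli words\<close>

datatype pauli_letter = PI | PX | PY | PZ

fun letter_mat :: "pauli_letter \<Rightarrow> complex mat" where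
  "letter_mat PI = 1\<^sub>m 2"
| "letter_mat PX = X_mat"
| "letter_mat PY = Y_mat"
| "letter_mat PZ = Z_mat"

fun letter_mult :: "pauli_letter \<Rightarrow> pauli_letter \<Rightarrow> pauli_letter" where
  "letter_mult PI p = p"
| "letter_mult p PI = p"
| "letter_mult PX PX = PI"
| "letter_mult PX PY = PZ"
| "letter_mult PX PZ = PY"
| "letter_mult PY PX = PZ"
| "letter_mult PY PY = PI"
| "letter_mult PY PZ = PX"
| "letter_mult PZ PX = PY"
| "letter_mult PZ PY = PX"
| "letter_mult PZ PZ = PI"

fun letter_phase :: "pauli_letter \<Rightarrow> pauli_letter \<Rightarrow> complex" where
  "letter_phase PX PY = \<i>"
| "letter_phase PX PZ = -\<i>"
| "letter_phase PY PX = -\<i>"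
| "letter_phase PY PZ = \<i>"
| "letter_phase PZ PX = \<i>"
| "letter_phase PZ PY = -\<i>"
| "letter_phase p q = 1"

type_synonym pauli_word = "complex \<times> pauli_letter list"

fun word_mat :: "pauli_word \<Rightarrow> complex mat" where
  "word_mat (c, ps) = c \<cdot>\<^sub>m tensor_list (map letter_mat ps)"

definition words :: "nat \<Rightarrow> pauli_word set" where
  "words n = pauli_scalars \<times> {ps. length ps = n}"

text \<open>The phases of the letter products are collected in the scalar. Since \<open>map2\<close>
  truncates, this describes the operator product only for words of equal length.\<close>

fun word_mult :: "pauli_word \<Rightarrow> pauli_word \<Rightarrow> pauli_word" where
  "word_mult (c, ps) (d, qs) = (c * d * prod_list (map2 letter_phase ps qs), map2 letter_mult ps qs)"

abbreviation mat22 :: "complex \<Rightarrow> complex \<Rightarrow> complex \<Rightarrow> complex \<Rightarrow> complex mat" where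
  "mat22 a b c d \<equiv> mat_of_rows_list 2 [[a, b], [c, d]]"

lemma mat22_carrier [simp]: "mat22 a b c d \<in> carrier_mat 2 2"
  by (simp add: mat_of_rows_list_def numeral_2_eq_2)

lemma mat22_index [simp]:
  "mat22 a b c d $$ (0, 0) = a" "mat22 a b c d $$ (0, Suc 0) = b"
  "mat22 a b c d $$ (Suc 0, 0) = c" "mat22 a b c d $$ (Suc 0, Suc 0) = d"
  by (simp_all add: mat_of_rows_list_def)

lemma mat22_eqI:
  assumes "A \<in> carrier_mat 2 2" "B \<in> carrier_mat 2 2"
    "A $$ (0, 0) = B $$ (0, 0)" "A $$ (0, Suc 0) = B $$ (0, Suc 0)"
    "A $$ (Suc 0, 0) = B $$ (Suc 0, 0)" "A $$ (Suc 0, Suc 0) = B $$ (Suc 0, Suc 0)"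
  shows "A = B"
  using assms by (intro eq_matI) (auto simp: numeral_2_eq_2 less_Suc_eq)

lemma mat22_mult:
  "mat22 a b c d * mat22 a' b' c' d' =
   mat22 (a * a' + b * c') (a * b' + b * d') (c * a' + d * c') (c * b' + d * d')"
  by (rule mat22_eqI) (auto simp: mat_of_rows_list_def scalar_prod_def numeral_2_eq_2)

lemma mat22_smult: "x \<cdot>\<^sub>m mat22 a b c d = mat22 (x * a) (x * b) (x * c) (x * d)"
  by (rule mat22_eqI) (auto simp: mat_of_rows_list_def)

lemma one_mat22: "1\<^sub>m 2 = mat22 1 0 0 1"
  by (rule mat22_eqI) (auto simp: mat_of_rows_list_def)

lemmas mat22_simps = H_mat_def S_mat_def X_mat_def Y_mat_def Z_mat_def one_mat22 mat22_mult mat22_smult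

lemma letter_mat_carrier [simp]: "letter_mat p \<in> carrier_mat 2 2"
  by (cases p) (simp_all add: mat22_simps)

lemma letter_mat_mult: "letter_mat p * letter_mat q = letter_phase p q \<cdot>\<^sub>m letter_mat (letter_mult p q)"
  by (cases p; cases q; simp add: mat22_simps)

lemma tensor_list_carrier [simp]: "tensor_list (map letter_mat ps) \<in> carrier_mat (2 ^ length ps) (2 ^ length ps)"
  by (induction ps) auto

lemma word_mat_carrier [simp]:
  "P \<in> words n \<Longrightarrow> word_mat P \<in> carrier_mat (2 ^ n) (2 ^ n)"
  by (auto simp: words_def)

lemma tensor_list_mult:
  "length ps = length qs \<Longrightarrow>
   tensor_list (map letter_mat ps) * tensor_list (map letter_mat qs) =
   prod_list (map2 letter_phase ps qs) \<cdot>\<^sub>m tensor_list (map letter_mat (map2 letter_mult ps qs))"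
proof (induction ps qs rule: list_induct2)
  case (Cons p ps q qs)
  then show ?case
    using tensor_mat_mult[of "letter_mat p" 2 2 "tensor_list (map letter_mat ps)" "2 ^ length ps" "2 ^ length ps"
        "letter_mat q" 2 "tensor_list (map letter_mat qs)" "2 ^ length ps"] tensor_list_carrier[of ps] tensor_list_carrier[of qs]
    by (simp add: letter_mat_mult tensor_mat_smult smult_smult_mat mult.commute)
qed simp

lemma word_mat_mult:
  assumes "P \<in> words n" "Q \<in> words n"
  shows "word_mat P * word_mat Q = word_mat (word_mult P Q)"
proof -
  obtain c ps d qs where [simp]: "P = (c, ps)" "Q = (d, qs)" by fastforce
  have l: "length ps = n" "length qs = n" using assms by (auto simp: words_def)
  have "word_mat P * word_mat Q =
    c \<cdot>\<^sub>m (d \<cdot>\<^sub>m (tensor_list (map letter_mat ps) * tensor_list (map letter_mat qs)))"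
    using mult_smult_distrib[OF smult_carrier_mat[OF tensor_list_carrier[of ps]], of "tensor_list (map letter_mat qs)"]
      mult_smult_assoc_mat[OF tensor_list_carrier[of ps]] tensor_list_carrier[of qs] l
    by (auto simp: smult_smult_mat mult.commute)
  then show ?thesis using l by (simp add: tensor_list_mult smult_smult_mat mult_ac)
qed

lemma pauli_scalars_closed: "c \<in> pauli_scalars \<Longrightarrow> d \<in> pauli_scalars \<Longrightarrow> c * d \<in> pauli_scalars"
  by (auto simp: pauli_scalars_def)

lemma letter_phase_in: "letter_phase p q \<in> pauli_scalars"
  by (cases p; cases q) (auto simp: pauli_scalars_def)

lemma prod_list_pauli_scalars: "set cs \<subseteq> pauli_scalars \<Longrightarrow> prod_list cs \<in> pauli_scalars"
  by (induction cs) (auto intro: pauli_scalars_closed, simp add: pauli_scalars_def)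

lemma word_mult_closed: "P \<in> words n \<Longrightarrow> Q \<in> words n \<Longrightarrow> word_mult P Q \<in> words n"
  by (cases P; cases Q)
    (auto simp: words_def letter_phase_in intro!: pauli_scalars_closed prod_list_pauli_scalars)

lemma word_one_in: "c \<in> pauli_scalars \<Longrightarrow> (c, replicate n PI) \<in> words n"
  by (simp add: words_def)

lemma tensor_list_PI: "tensor_list (map letter_mat (replicate n PI)) = 1\<^sub>m (2 ^ n)"
  by (induction n) (simp_all add: tensor_mat_one)

lemma word_mat_scalar: "word_mat (c, replicate n PI) = c \<cdot>\<^sub>m 1\<^sub>m (2 ^ n)"
  by (simp add: tensor_list_PI del: map_replicate)

lemma letter_mult_self [simp]: "letter_mult p p = PI" and letter_phase_self [simp]: "letter_phase p p = 1"
  by (cases p; simp)+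

lemma map2_same: "map2 f xs xs = map (\<lambda>x. f x x) xs"
  by (induction xs) auto

lemma word_mult_self: "word_mult (c, ps) (c, ps) = (c * c, replicate (length ps) PI)"
  by (simp add: map2_same map_replicate_const)

text \<open>Every letter squares to the identity, hence so does the whole product, which therefore
  cannot vanish.\<close>

lemma tensor_list_nonzero:
  "tensor_list (map letter_mat ps) \<noteq> 0\<^sub>m (2 ^ length ps) (2 ^ length ps)"
proof
  assume 0: "tensor_list (map letter_mat ps) = 0\<^sub>m (2 ^ length ps) (2 ^ length ps)"
  have "tensor_list (map letter_mat ps) * tensor_list (map letter_mat ps) = 1 \<cdot>\<^sub>m 1\<^sub>m (2 ^ length ps)"
    by (subst tensor_list_mult)
      (simp_all add: map2_same map_replicate_const tensor_list_PI tensor_list_PI[simplified])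
  then have "(0\<^sub>m (2 ^ length ps) (2 ^ length ps) :: complex mat) $$ (0, 0) = 1 * (1\<^sub>m (2 ^ length ps) $$ (0, 0))"
    unfolding 0 by simp
  then show False by simp
qed

lemma smult_mat_cancel:
  fixes A :: "complex mat"
  assumes "c \<cdot>\<^sub>m A = d \<cdot>\<^sub>m A" "A \<in> carrier_mat n n" "A \<noteq> 0\<^sub>m n n"
  shows "c = d"
proof (rule ccontr)
  assume "c \<noteq> d"
  have "A $$ (i, j) = 0" if "i < n" "j < n" for i j
  proof -
    have "c * A $$ (i, j) = d * A $$ (i, j)"
      using arg_cong[OF assms(1), of "\<lambda>M. M $$ (i, j)"] assms(2) that by simp
    then show ?thesis using \<open>c \<noteq> d\<close> by simp
  qed
  then have "A = 0\<^sub>m n n" using assms(2) by (intro eq_matI) auto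
  with assms(3) show False by simp
qed

text \<open>Compare the four blocks given by the first letters. I and Z are supported on the
  diagonal, X and Y off it, so different supports would force a scalar to be 0. Different letters
  with the same support have opposite relative signs in their two entries, which is impossible too.
  For equal letters one block reduces the claim to the tails.\<close>

lemma tensor_list_inj:
  assumes "length ps = length qs" "c \<noteq> 0" "d \<noteq> 0"
    "c \<cdot>\<^sub>m tensor_list (map letter_mat ps) = d \<cdot>\<^sub>m tensor_list (map letter_mat qs)"
  shows "c = d \<and> ps = qs"
  using assms
proof (induction ps qs arbitrary: c d rule: list_induct2)
  case Nil
  then have "(c \<cdot>\<^sub>m 1\<^sub>m 1) $$ (0, 0) = (d \<cdot>\<^sub>m 1\<^sub>m 1 :: complex mat) $$ (0, 0)" by simp
  then show ?case by simp
next
  case (Cons p ps q qs)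
  define A where "A = tensor_list (map letter_mat ps)"
  define B where "B = tensor_list (map letter_mat qs)"
  let ?n = "2 ^ length ps :: nat"
  have A: "A \<in> carrier_mat ?n ?n" and B: "B \<in> carrier_mat ?n ?n"
    using tensor_list_carrier[of ps] tensor_list_carrier[of qs] Cons.hyps by (simp_all add: A_def B_def)
  have A0: "A \<noteq> 0\<^sub>m ?n ?n" and B0: "B \<noteq> 0\<^sub>m ?n ?n"
    using tensor_list_nonzero[of ps] tensor_list_nonzero[of qs] Cons.hyps by (simp_all add: A_def B_def)
  have eq: "tensor_mat (letter_mat p) (c \<cdot>\<^sub>m A) = tensor_mat (letter_mat q) (d \<cdot>\<^sub>m B)"
    using Cons.prems by (simp add: A_def B_def tensor_mat_smult)
  have blk: "(letter_mat p $$ (i, j) * c) \<cdot>\<^sub>m A = (letter_mat q $$ (i, j) * d) \<cdot>\<^sub>m B" if "i < 2" "j < 2" for i j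
    using tensor_mat_block[OF eq letter_mat_carrier letter_mat_carrier
        smult_carrier_mat[OF A] smult_carrier_mat[OF B] that]
    by (simp add: smult_smult_mat)
  \<comment> \<open>Both sides are the zero matrix. Writing it as a multiple of \<open>A\<close> and
    also of \<open>B\<close> lets a mixed equation be fed to
    \<open>smult_mat_cancel\<close>.\<close>
  have z: "0 \<cdot>\<^sub>m A = 0 \<cdot>\<^sub>m B"
    using A B by (intro eq_matI) auto
  have zero: "x \<cdot>\<^sub>m A = 0 \<cdot>\<^sub>m B \<Longrightarrow> x = 0" "0 \<cdot>\<^sub>m A = x \<cdot>\<^sub>m B \<Longrightarrow> x = 0" for x
    using smult_mat_cancel[OF _ A A0, of x 0] smult_mat_cancel[OF _ B B0, of 0 x] z by metis+
  have IH: "x \<cdot>\<^sub>m A = y \<cdot>\<^sub>m B \<Longrightarrow> x \<noteq> 0 \<Longrightarrow> y \<noteq> 0 \<Longrightarrow> x = y \<and> ps = qs" for x y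
    using Cons.IH by (simp add: A_def B_def)
  have neg: "x \<cdot>\<^sub>m B = - x \<cdot>\<^sub>m B \<Longrightarrow> x = 0" "- x \<cdot>\<^sub>m B = x \<cdot>\<^sub>m B \<Longrightarrow> x = 0" for x
    using smult_mat_cancel[OF _ B B0, of x "- x"] smult_mat_cancel[OF _ B B0, of "- x" x]
    by (auto simp: complex_eq_iff)
  show ?case
    using blk[of 0 0] blk[of 0 1] blk[of 1 0] blk[of 1 1] Cons.prems(1,2)
    by (cases p; cases q; auto simp: mat22_simps dest!: zero IH neg)
qed

lemma pauli_scalars_nonzero: "c \<in> pauli_scalars \<Longrightarrow> c \<noteq> 0"
  by (auto simp: pauli_scalars_def)

lemma word_mat_inj: "inj_on word_mat (words n)"
  by (auto intro!: inj_onI simp: words_def dest!: pauli_scalars_nonzero tensor_list_inj[rotated 3])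

lemma word_mat_image: "word_mat ` words n = carrier (pauli_group n)"
proof
  show "word_mat ` words n \<subseteq> carrier (pauli_group n)"
  proof (clarsimp simp: words_def pauli_group_def)
    fix c and ps :: "pauli_letter list" assume "c \<in> pauli_scalars" "n = length ps"
    moreover have "set (map letter_mat ps) \<subseteq> {1\<^sub>m 2, X_mat, Y_mat, Z_mat}"
      by (auto, metis letter_mat.elims)
    ultimately show "\<exists>d Ps. c \<cdot>\<^sub>m tensor_list (map letter_mat ps) = d \<cdot>\<^sub>m tensor_list Ps \<and>
      d \<in> pauli_scalars \<and> length Ps = length ps \<and> set Ps \<subseteq> {1\<^sub>m 2, X_mat, Y_mat, Z_mat}"
      by (metis length_map)
  qed
next
  have *: "\<exists>ps. map letter_mat ps = Ps" if "set Ps \<subseteq> {1\<^sub>m 2, X_mat, Y_mat, Z_mat}" for Ps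
  proof -
    have "{1\<^sub>m 2, X_mat, Y_mat, Z_mat} \<subseteq> range letter_mat"
      by (auto intro: range_eqI[of _ _ PI] range_eqI[of _ _ PX] range_eqI[of _ _ PY] range_eqI[of _ _ PZ])
    then have "\<forall>A\<in>set Ps. \<exists>p. A = letter_mat p" using that by blast
    then show ?thesis by (metis ex_map_conv)
  qed
  show "carrier (pauli_group n) \<subseteq> word_mat ` words n"
  proof
    fix P assume "P \<in> carrier (pauli_group n)"
    then obtain c Ps where P: "P = c \<cdot>\<^sub>m tensor_list Ps" "c \<in> pauli_scalars" "length Ps = n"
      "set Ps \<subseteq> {1\<^sub>m 2, X_mat, Y_mat, Z_mat}"
      by (auto simp: pauli_group_def)
    obtain ps where "map letter_mat ps = Ps" using *[OF P(4)] by blast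
    then have "P = word_mat (c, ps)" "(c, ps) \<in> words n" using P by (auto simp: words_def)
    then show "P \<in> word_mat ` words n" by blast
  qed
qed

text \<open>This makes words a faithful model of the Pauli group, through which the given
  automorphism is transported in the end.\<close>

lemma word_mat_bij: "bij_betw word_mat (words n) (carrier (pauli_group n))"
  by (simp add: bij_betw_def word_mat_inj word_mat_image)

section \<open>Conjugation of Pauli words by single gates\<close>

fun had_letter :: "pauli_letter \<Rightarrow> complex \<times> pauli_letter" where
  "had_letter PI = (1, PI)"
| "had_letter PX = (1, PZ)"
| "had_letter PY = (-1, PY)"
| "had_letter PZ = (1, PX)"

fun phase_letter :: "pauli_letter \<Rightarrow> complex \<times> pauli_letter" where
  "phase_letter PI = (1, PI)"
| "phase_letter PX = (1, PY)"
| "phase_letter PY = (-1, PX)"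
| "phase_letter PZ = (1, PZ)"

fun anti_Z :: "pauli_letter \<Rightarrow> bool" where
  "anti_Z PX = True"
| "anti_Z PY = True"
| "anti_Z _ = False"

text \<open>Controlled Z commutes with I and Z on either qubit, while an X or Y on one qubit
  contributes a factor Z on the other. Only the letter is kept here; the phase is left to
  \<open>cz_sign\<close>.\<close>

definition cz_letter :: "pauli_letter \<Rightarrow> pauli_letter \<Rightarrow> pauli_letter" where
  "cz_letter p q = (if anti_Z q then letter_mult p PZ else p)"

text \<open>Controlled Z sends X \<otimes> X to Y \<otimes> Y but X \<otimes> Y to -Y \<otimes> X.
  The equation between sets covers both orders of the letters.\<close>

definition cz_sign :: "pauli_letter \<Rightarrow> pauli_letter \<Rightarrow> complex" where
  "cz_sign p q = (if {p, q} = {PX, PY} then -1 else 1)"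

text \<open>Qubits count from 1 and list positions from 0, so qubit \<open>q\<close> sits at
  position \<open>q - 1\<close>. For controlled Z both new letters are computed from the old word. A
  global phase cancels under conjugation, so \<open>Omega\<close> acts trivially.\<close>

fun gate_act :: "gate \<Rightarrow> pauli_word \<Rightarrow> pauli_word" where
  "gate_act (Had q) (c, ps) =
     (c * fst (had_letter (ps ! (q - 1))), ps[q - 1 := snd (had_letter (ps ! (q - 1)))])"
| "gate_act (Phase q) (c, ps) =
     (c * fst (phase_letter (ps ! (q - 1))), ps[q - 1 := snd (phase_letter (ps ! (q - 1)))])"
| "gate_act (CZ q) (c, ps) =
     (c * cz_sign (ps ! (q - 1)) (ps ! q),
      ps[q - 1 := cz_letter (ps ! (q - 1)) (ps ! q), q := cz_letter (ps ! q) (ps ! (q - 1))])"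
| "gate_act Omega P = P"

definition circ_act :: "gate list \<Rightarrow> pauli_word \<Rightarrow> pauli_word" where
  "circ_act gs = fold gate_act gs"

fun valid_gate :: "nat \<Rightarrow> gate \<Rightarrow> bool" where
  "valid_gate n (Had q) \<longleftrightarrow> 1 \<le> q \<and> q \<le> n"
| "valid_gate n (Phase q) \<longleftrightarrow> 1 \<le> q \<and> q \<le> n"
| "valid_gate n (CZ q) \<longleftrightarrow> 1 \<le> q \<and> q + 1 \<le> n"
| "valid_gate n Omega \<longleftrightarrow> True"

lemma mat4_eqI:
  assumes "A \<in> carrier_mat 4 4" "B \<in> carrier_mat 4 4"
    "\<And>i j. i \<in> {0, Suc 0, 2, 3} \<Longrightarrow> j \<in> {0, Suc 0, 2, 3} \<Longrightarrow> A $$ (i, j) = B $$ (i, j)"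
  shows "A = B"
  using assms by (intro eq_matI) (auto simp: numeral_eq_Suc less_Suc_eq)

lemma H_mat_carrier [simp]: "H_mat \<in> carrier_mat 2 2"
  and S_mat_carrier [simp]: "S_mat \<in> carrier_mat 2 2"
  by (simp_all add: mat22_simps)

lemma Zc_mat_carrier [simp]: "Zc_mat \<in> carrier_mat 4 4"
  unfolding Zc_mat_def mat_of_rows_list_def by (rule carrier_matI) simp_all

definition cz_diag :: "nat \<Rightarrow> complex" where
  "cz_diag i = (if i = 3 then -1 else 1)"

lemma Zc_mat_index: "i < 4 \<Longrightarrow> j < 4 \<Longrightarrow> Zc_mat $$ (i, j) = (if i = j then cz_diag i else 0)"
  by (auto simp: Zc_mat_def mat_of_rows_list_def cz_diag_def numeral_eq_Suc less_Suc_eq)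

lemma Zc_mat_mult_left:
  assumes A: "A \<in> carrier_mat 4 4" and ij: "i < 4" "j < 4"
  shows "(Zc_mat * A) $$ (i, j) = cz_diag i * A $$ (i, j)"
proof -
  have "(Zc_mat * A) $$ (i, j) = (\<Sum>k<4. Zc_mat $$ (i, k) * A $$ (k, j))"
    using carrier_matD[OF A] carrier_matD[OF Zc_mat_carrier] ij
    by (simp add: scalar_prod_def atLeast0LessThan)
  also have "\<dots> = (\<Sum>k<4. if i = k then cz_diag i * A $$ (i, j) else 0)"
    using ij by (intro sum.cong) (auto simp: Zc_mat_index)
  finally show ?thesis using ij by simp
qed

lemma Zc_mat_mult_right:
  assumes A: "A \<in> carrier_mat 4 4" and ij: "i < 4" "j < 4"
  shows "(A * Zc_mat) $$ (i, j) = A $$ (i, j) * cz_diag j"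
proof -
  have "(A * Zc_mat) $$ (i, j) = (\<Sum>k<4. A $$ (i, k) * Zc_mat $$ (k, j))"
    using carrier_matD[OF A] carrier_matD[OF Zc_mat_carrier] ij
    by (simp add: scalar_prod_def atLeast0LessThan)
  also have "\<dots> = (\<Sum>k<4. if j = k then A $$ (i, j) * cz_diag j else 0)"
    using ij by (intro sum.cong) (auto simp: Zc_mat_index)
  finally show ?thesis using ij by simp
qed

text \<open>The rule for conjugation is stated as a commutation rule, which avoids the inverse of
  the gate. The factor 1 / sqrt 2 then occurs once on each side and need not be evaluated.\<close>

lemma H_mat_letter:
  "H_mat * letter_mat p = fst (had_letter p) \<cdot>\<^sub>m (letter_mat (snd (had_letter p)) * H_mat)"
  by (cases p; simp add: mat22_simps)

lemma S_mat_letter: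
  "S_mat * letter_mat p = fst (phase_letter p) \<cdot>\<^sub>m (letter_mat (snd (phase_letter p)) * S_mat)"
  by (cases p; simp add: mat22_simps)

text \<open>As \<open>Zc_mat\<close> is diagonal, multiplying by it scales rows or columns, so the
  identity can be checked entry by entry without expanding matrix products.\<close>

lemma Zc_mat_letter:
  "Zc_mat * tensor_mat (letter_mat p) (letter_mat q) =
   cz_sign p q \<cdot>\<^sub>m (tensor_mat (letter_mat (cz_letter p q)) (letter_mat (cz_letter q p)) * Zc_mat)"
proof (rule mat4_eqI)
  have T: "tensor_mat (letter_mat a) (letter_mat b) \<in> carrier_mat 4 4" for a b
    using tensor_mat_carrier[OF letter_mat_carrier[of a] letter_mat_carrier[of b]] by simp
  show "Zc_mat * tensor_mat (letter_mat p) (letter_mat q) \<in> carrier_mat 4 4"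
    using T Zc_mat_carrier by (metis mult_carrier_mat)
  show "cz_sign p q \<cdot>\<^sub>m (tensor_mat (letter_mat (cz_letter p q)) (letter_mat (cz_letter q p)) * Zc_mat) \<in> carrier_mat 4 4"
    using T Zc_mat_carrier by (metis mult_carrier_mat smult_carrier_mat)
  fix i j :: nat assume ij: "i \<in> {0, Suc 0, 2, 3}" "j \<in> {0, Suc 0, 2, 3}"
  then have lt: "i < 4" "j < 4" by auto
  have ind: "tensor_mat (letter_mat a) (letter_mat b) $$ (i, j) =
      letter_mat a $$ (i div 2, j div 2) * letter_mat b $$ (i mod 2, j mod 2)" for a b
    using lt carrier_matD[OF letter_mat_carrier] by (subst tensor_mat_index) auto
  have "cz_diag i * (letter_mat p $$ (i div 2, j div 2) * letter_mat q $$ (i mod 2, j mod 2)) =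
     cz_sign p q * (letter_mat (cz_letter p q) $$ (i div 2, j div 2) *
       letter_mat (cz_letter q p) $$ (i mod 2, j mod 2) * cz_diag j)"
    using ij
    by (cases p; cases q)
      (auto simp: mat22_simps cz_diag_def cz_letter_def cz_sign_def doubleton_eq_iff)
  then show "(Zc_mat * tensor_mat (letter_mat p) (letter_mat q)) $$ (i, j) =
    (cz_sign p q \<cdot>\<^sub>m (tensor_mat (letter_mat (cz_letter p q)) (letter_mat (cz_letter q p)) * Zc_mat)) $$ (i, j)"
    using lt carrier_matD[OF mult_carrier_mat[OF T Zc_mat_carrier]]
    by (simp only: index_smult_mat Zc_mat_mult_left[OF T lt] Zc_mat_mult_right[OF T lt] ind)
qed

text \<open>The identities on the outer factors commute with the letters in \<open>us\<close> and
  \<open>vs\<close>, so the mixed product rule lifts a commutation rule on the affected qubits to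
  the whole word, with the sign absorbed into the scalar.\<close>

lemma local_gate_mult:
  assumes U: "U \<in> carrier_mat (2 ^ length xs) (2 ^ length xs)" and l: "length ys = length xs"
    and comm: "U * tensor_list (map letter_mat xs) = s \<cdot>\<^sub>m (tensor_list (map letter_mat ys) * U)"
  shows "tensor_mat (1\<^sub>m (2 ^ length us)) (tensor_mat U (1\<^sub>m (2 ^ length vs))) * word_mat (c, us @ xs @ vs) =
    word_mat (c * s, us @ ys @ vs) * tensor_mat (1\<^sub>m (2 ^ length us)) (tensor_mat U (1\<^sub>m (2 ^ length vs)))"
proof -
  let ?T = "\<lambda>ps. tensor_list (map letter_mat ps)"
  let ?G = "tensor_mat (1\<^sub>m (2 ^ length us)) (tensor_mat U (1\<^sub>m (2 ^ length vs)))"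
  let ?N = "2 ^ length us * (2 ^ length xs * 2 ^ length vs) :: nat"
  have Y: "?T ys \<in> carrier_mat (2 ^ length xs) (2 ^ length xs)"
    using tensor_list_carrier[of ys] l by simp
  note one = one_carrier_mat
  note T = tensor_list_carrier
  have G: "?G \<in> carrier_mat ?N ?N" using U by simp
  have W: "tensor_mat (?T us) (tensor_mat (?T xs) (?T vs)) \<in> carrier_mat ?N ?N"
    "tensor_mat (?T us) (tensor_mat (?T ys) (?T vs)) \<in> carrier_mat ?N ?N"
    by (intro tensor_mat_carrier T Y)+
  have "?G * tensor_mat (?T us) (tensor_mat (?T xs) (?T vs)) =
      tensor_mat (?T us) (tensor_mat (U * ?T xs) (?T vs))"
    using left_mult_one_mat[OF T[of us]] left_mult_one_mat[OF T[of vs]]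
    by (simp add: tensor_mat_mult[OF one tensor_mat_carrier[OF U one] T tensor_mat_carrier[OF T T]]
        tensor_mat_mult[OF U one T T])
  also have "\<dots> = s \<cdot>\<^sub>m tensor_mat (?T us) (tensor_mat (?T ys * U) (?T vs))"
    by (simp add: comm tensor_mat_smult)
  also have "tensor_mat (?T us) (tensor_mat (?T ys * U) (?T vs)) =
      tensor_mat (?T us) (tensor_mat (?T ys) (?T vs)) * ?G"
    using right_mult_one_mat[OF T[of us]] right_mult_one_mat[OF T[of vs]]
    by (simp add: tensor_mat_mult[OF T tensor_mat_carrier[OF Y T] one tensor_mat_carrier[OF U one]]
        tensor_mat_mult[OF Y T U one])
  finally have eq: "?G * tensor_mat (?T us) (tensor_mat (?T xs) (?T vs)) =
      s \<cdot>\<^sub>m (tensor_mat (?T us) (tensor_mat (?T ys) (?T vs)) * ?G)" .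
  have "?G * (c \<cdot>\<^sub>m tensor_mat (?T us) (tensor_mat (?T xs) (?T vs))) =
      (c * s) \<cdot>\<^sub>m (tensor_mat (?T us) (tensor_mat (?T ys) (?T vs)) * ?G)"
    by (simp add: mult_smult_distrib[OF G W(1)] eq smult_smult_mat)
  also have "\<dots> = ((c * s) \<cdot>\<^sub>m tensor_mat (?T us) (tensor_mat (?T ys) (?T vs))) * ?G"
    by (simp add: mult_smult_assoc_mat[OF W(2) G])
  finally show ?thesis by (simp add: tensor_list_append)
qed

lemma split_at_qubit:
  assumes "1 \<le> q" "q \<le> length ps"
  obtains us p vs where "ps = us @ [p] @ vs" "length us = q - 1" "length vs = length ps - q"
proof
  show "ps = take (q - 1) ps @ [ps ! (q - 1)] @ drop q ps"
    using assms id_take_nth_drop[of "q - 1" ps] by simp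
qed (use assms in auto)

lemma split_at_qubits:
  assumes "1 \<le> q" "q + 1 \<le> length ps"
  obtains us p r vs where "ps = us @ [p, r] @ vs" "length us = q - 1" "length vs = length ps - (q + 1)"
proof
  show "ps = take (q - 1) ps @ [ps ! (q - 1), ps ! q] @ drop (q + 1) ps"
    using assms id_take_nth_drop[of "q - 1" ps] Cons_nth_drop_Suc[of q ps] by simp
qed (use assms in auto)

lemma gate_op_word_mat:
  assumes "valid_gate (length ps) g"
  shows "gate_op (length ps) g * word_mat (c, ps) = word_mat (gate_act g (c, ps)) * gate_op (length ps) g"
proof (cases g)
  case (Had q)
  then obtain us p vs where ps: "ps = us @ [p] @ vs" and q: "length us = q - 1" "length vs = length ps - q"
    using assms split_at_qubit[of q ps] by auto
  \<comment> \<open>Written this way, position \<open>q - 1\<close> becomes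
    \<open>length us\<close>, which is exactly where \<open>p\<close> stands.\<close>
  have q1: "q = Suc (length us)" using q assms Had by simp
  show ?thesis
    using local_gate_mult[of H_mat "[p]" "[snd (had_letter p)]" "fst (had_letter p)" us vs c] H_mat_letter[of p]
    unfolding Had gate_op.simps q[symmetric] unfolding ps q1
    by (simp add: nth_append list_update_append)
next
  case (Phase q)
  then obtain us p vs where ps: "ps = us @ [p] @ vs" and q: "length us = q - 1" "length vs = length ps - q"
    using assms split_at_qubit[of q ps] by auto
  have q1: "q = Suc (length us)" using q assms Phase by simp
  show ?thesis
    using local_gate_mult[of S_mat "[p]" "[snd (phase_letter p)]" "fst (phase_letter p)" us vs c] S_mat_letter[of p]
    unfolding Phase gate_op.simps q[symmetric] unfolding ps q1
    by (simp add: nth_append list_update_append)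
next
  case (CZ q)
  then have "1 \<le> q" "q + 1 \<le> length ps" using assms by auto
  then obtain us p r vs where ps: "ps = us @ [p, r] @ vs"
    and q: "length us = q - 1" "length vs = length ps - (q + 1)"
    by (rule split_at_qubits)
  have q1: "q = Suc (length us)" using q assms CZ by simp
  show ?thesis
    using local_gate_mult[of Zc_mat "[p, r]" "[cz_letter p r, cz_letter r p]" "cz_sign p r" us vs c] Zc_mat_letter[of p r]
    unfolding CZ gate_op.simps q[symmetric] unfolding ps q1
    by (simp add: nth_append list_update_append)
next
  case Omega
  have "word_mat (c, ps) \<in> carrier_mat (2 ^ length ps) (2 ^ length ps)"
    using tensor_list_carrier[of ps] by simp
  note w = this one_carrier_mat[of "2 ^ length ps"]
  show ?thesis
    unfolding Omega gate_op.simps gate_act.simps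
    using left_mult_one_mat[OF w(1)] right_mult_one_mat[OF w(1)]
      mult_smult_distrib[OF w] mult_smult_assoc_mat[OF w(2,1)] by simp
qed

subsection \<open>Circuits acting on Pauli words\<close>

text \<open>Invertibility is phrased through units of the matrix ring because the facts about
  \<open>mat_inverse\<close> are stated for them.\<close>

abbreviation mat_units :: "nat \<Rightarrow> complex mat set" where
  "mat_units N \<equiv> Units (ring_mat TYPE(complex) N ())"

lemma mat_units_iff:
  "U \<in> mat_units N \<longleftrightarrow>
   U \<in> carrier_mat N N \<and> (\<exists>V\<in>carrier_mat N N. V * U = 1\<^sub>m N \<and> U * V = 1\<^sub>m N)"
  by (auto simp: Units_def ring_mat_simps)

lemma mat_units_mult: "U \<in> mat_units N \<Longrightarrow> V \<in> mat_units N \<Longrightarrow> U * V \<in> mat_units N"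
  using monoid.Units_m_closed[OF ring.is_monoid[OF ring_mat]] by (metis ring_mat_simps(1))

lemma mat_units_cancel:
  assumes "U \<in> mat_units N" "A \<in> carrier_mat N N" "B \<in> carrier_mat N N"
  shows "U * A = U * B \<Longrightarrow> A = B" "A * U = B * U \<Longrightarrow> A = B"
proof -
  obtain V where V: "V \<in> carrier_mat N N" "V * U = 1\<^sub>m N" "U * V = 1\<^sub>m N" and U: "U \<in> carrier_mat N N"
    using assms(1) by (auto simp: mat_units_iff)
  show "A = B" if "U * A = U * B"
    using arg_cong[OF that, of "\<lambda>M. V * M"] V U assms(2,3)
    by (simp add: assoc_mult_mat[symmetric, of _ N N _ N _ N])
  show "A = B" if "A * U = B * U"
    using arg_cong[OF that, of "\<lambda>M. M * V"] V U assms(2,3)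
    by (simp add: assoc_mult_mat[of _ N N _ N _ N])
qed

text \<open>Invertibility guarantees that \<open>mat_inverse U\<close> is not \<open>None\<close>,
  so the \<open>the\<close> in \<open>conj_act\<close> yields the true inverse; multiplying the
  commutation rule by it on the right gives the claim.\<close>

lemma conj_act_eq:
  assumes "U \<in> mat_units N" "A \<in> carrier_mat N N" "B \<in> carrier_mat N N" "U * A = B * U"
  shows "U \<bullet>\<^sub>C A = B"
proof -
  have U: "U \<in> carrier_mat N N" using assms(1) by (simp add: mat_units_iff)
  obtain V where V: "mat_inverse U = Some V"
    using mat_inverse(1)[OF U, of "()"] assms(1) by (cases "mat_inverse U") auto
  note V' = mat_inverse(2)[OF U V]
  have "U * A * V = B * (U * V)"
    using assms U V' by (simp add: assoc_mult_mat[of _ N N _ N _ N])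
  then show ?thesis using V V' assms(3) by (simp add: conj_act_def)
qed

lemma local_gate_unit:
  assumes "U \<in> mat_units k"
  shows "tensor_mat (1\<^sub>m a) (tensor_mat U (1\<^sub>m b)) \<in> mat_units (a * (k * b))"
proof -
  obtain V where U: "U \<in> carrier_mat k k" and V: "V \<in> carrier_mat k k" "V * U = 1\<^sub>m k" "U * V = 1\<^sub>m k"
    using assms by (auto simp: mat_units_iff)
  have *: "tensor_mat (1\<^sub>m a) (tensor_mat A (1\<^sub>m b)) * tensor_mat (1\<^sub>m a) (tensor_mat B (1\<^sub>m b)) = 1\<^sub>m (a * (k * b))"
    if "A \<in> carrier_mat k k" "B \<in> carrier_mat k k" "A * B = 1\<^sub>m k" for A B
    using that
    by (simp add: tensor_mat_mult[OF one_carrier_mat tensor_mat_carrier[OF that(1) one_carrier_mat]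
          one_carrier_mat tensor_mat_carrier[OF that(2) one_carrier_mat]]
        tensor_mat_mult[OF that(1) one_carrier_mat that(2) one_carrier_mat] tensor_mat_one)
  have "tensor_mat (1\<^sub>m a) (tensor_mat M (1\<^sub>m b)) \<in> carrier_mat (a * (k * b)) (a * (k * b))"
    if "M \<in> carrier_mat k k" for M
    by (intro tensor_mat_carrier one_carrier_mat that)
  then show ?thesis
    unfolding mat_units_iff using *[OF V(1) U V(2)] *[OF U V(1) V(3)] U V(1) by blast
qed

lemma H_mat_unit: "H_mat \<in> mat_units 2"
proof -
  have "(1 / complex_of_real (sqrt 2)) * (1 / complex_of_real (sqrt 2)) = 1 / 2"
    by (simp flip: of_real_mult)
  then have "H_mat * H_mat = 1\<^sub>m 2" by (simp add: mat22_simps)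
  then show ?thesis unfolding mat_units_iff using H_mat_carrier by blast
qed

lemma S_mat_unit: "S_mat \<in> mat_units 2"
proof -
  have "S_mat * mat22 1 0 0 (-\<i>) = 1\<^sub>m 2" "mat22 1 0 0 (-\<i>) * S_mat = 1\<^sub>m 2"
    by (simp_all add: mat22_simps)
  then show ?thesis unfolding mat_units_iff using S_mat_carrier mat22_carrier by blast
qed

lemma Zc_mat_unit: "Zc_mat \<in> mat_units 4"
proof -
  have "Zc_mat * Zc_mat = 1\<^sub>m 4"
  proof (rule mat4_eqI)
    show "Zc_mat * Zc_mat \<in> carrier_mat 4 4" by (rule mult_carrier_mat[OF Zc_mat_carrier Zc_mat_carrier])
    fix i j :: nat assume "i \<in> {0, Suc 0, 2, 3}" "j \<in> {0, Suc 0, 2, 3}"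
    then have "i < 4" "j < 4" by auto
    then show "(Zc_mat * Zc_mat) $$ (i, j) = 1\<^sub>m 4 $$ (i, j)"
      by (simp add: Zc_mat_mult_left Zc_mat_index cz_diag_def)
  qed simp
  then show ?thesis unfolding mat_units_iff using Zc_mat_carrier by blast
qed

lemma omega_nonzero: "omega \<noteq> 0"
  by (simp add: omega_def)

lemma gate_op_unit:
  assumes "valid_gate n g"
  shows "gate_op n g \<in> mat_units (2 ^ n)"
proof (cases g)
  case (Had q)
  then have "n = (q - 1) + (1 + (n - q))" using assms by simp
  then have "2 ^ (q - 1) * (2 * 2 ^ (n - q)) = (2 ^ n :: nat)" by (metis power_add power_one_right)
  then show ?thesis using local_gate_unit[OF H_mat_unit, of "2 ^ (q - 1)" "2 ^ (n - q)"] Had by simp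
next
  case (Phase q)
  then have "n = (q - 1) + (1 + (n - q))" using assms by simp
  then have "2 ^ (q - 1) * (2 * 2 ^ (n - q)) = (2 ^ n :: nat)" by (metis power_add power_one_right)
  then show ?thesis using local_gate_unit[OF S_mat_unit, of "2 ^ (q - 1)" "2 ^ (n - q)"] Phase by simp
next
  case (CZ q)
  then have "1 \<le> q" "q + 1 \<le> n" using assms by auto
  then have "n = (q - 1) + (2 + (n - (q + 1)))" by arith
  then have "2 ^ (q - 1) * (2 ^ 2 * 2 ^ (n - (q + 1))) = (2 ^ n :: nat)" by (metis power_add)
  then have "2 ^ (q - 1) * (4 * 2 ^ (n - (q + 1))) = (2 ^ n :: nat)" by simp
  then show ?thesis
    using local_gate_unit[OF Zc_mat_unit, of "2 ^ (q - 1)" "2 ^ (n - (q + 1))"] CZ by simp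
next
  case Omega
  have "(inverse omega \<cdot>\<^sub>m 1\<^sub>m (2 ^ n)) * (omega \<cdot>\<^sub>m 1\<^sub>m (2 ^ n)) = 1\<^sub>m (2 ^ n)"
    "(omega \<cdot>\<^sub>m 1\<^sub>m (2 ^ n)) * (inverse omega \<cdot>\<^sub>m 1\<^sub>m (2 ^ n)) = 1\<^sub>m (2 ^ n)"
    using omega_nonzero by (simp_all add: mult_smult_distrib[of _ "2^n" "2^n" _ "2^n"]
        mult_smult_assoc_mat[of _ "2^n" "2^n" _ "2^n"] smult_smult_mat)
  then show ?thesis unfolding mat_units_iff Omega gate_op.simps by (metis one_carrier_mat smult_carrier_mat)
qed

lemma gate_act_words:
  assumes "P \<in> words n"
  shows "gate_act g P \<in> words n"
proof -
  obtain c ps where P: "P = (c, ps)" "c \<in> pauli_scalars" "length ps = n"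
    using assms by (auto simp: words_def)
  have "fst (had_letter p) \<in> pauli_scalars" "fst (phase_letter p) \<in> pauli_scalars"
    "cz_sign p q \<in> pauli_scalars" for p q
    by (cases p; simp add: pauli_scalars_def cz_sign_def)+
  then show ?thesis using P by (cases g) (auto simp: words_def intro: pauli_scalars_closed)
qed

lemma circ_act_Nil [simp]: "circ_act [] P = P"
  and circ_act_Cons [simp]: "circ_act (g # gs) P = circ_act gs (gate_act g P)"
  and circ_act_append [simp]: "circ_act (gs @ hs) P = circ_act hs (circ_act gs P)"
  by (simp_all add: circ_act_def)

lemma circ_act_words: "P \<in> words n \<Longrightarrow> circ_act gs P \<in> words n"
  by (induction gs arbitrary: P) (simp_all add: gate_act_words)

abbreviation valid_circ :: "nat \<Rightarrow> gate list \<Rightarrow> bool" where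
  "valid_circ n \<equiv> list_all (valid_gate n)"

lemma circuit_op_unit: "valid_circ n gs \<Longrightarrow> circuit_op n gs \<in> mat_units (2 ^ n)"
proof (induction gs)
  case Nil
  show ?case unfolding mat_units_iff circuit_op.simps by (metis one_carrier_mat left_mult_one_mat)
qed (simp add: gate_op_unit mat_units_mult)

lemma mat_units_carrier: "U \<in> mat_units N \<Longrightarrow> U \<in> carrier_mat N N"
  by (simp add: mat_units_iff)

text \<open>The first gate is the rightmost factor of \<open>circuit_op\<close>, so it meets the
  word first, in agreement with the left-to-right \<open>fold\<close> in
  \<open>circ_act\<close>.\<close>

lemma circuit_op_word_mat:
  "valid_circ n gs \<Longrightarrow> P \<in> words n \<Longrightarrow>
   circuit_op n gs * word_mat P = word_mat (circ_act gs P) * circuit_op n gs"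
proof (induction gs arbitrary: P)
  case Nil
  then show ?case 
    using left_mult_one_mat[OF word_mat_carrier] right_mult_one_mat[OF word_mat_carrier] by fastforce
next
  case (Cons g gs)
  obtain c ps where P: "P = (c, ps)" "length ps = n"
    using Cons.prems by (auto simp: words_def)
  let ?A = "circuit_op n gs" and ?G = "gate_op n g"
  have c: "?A \<in> carrier_mat (2 ^ n) (2 ^ n)" "?G \<in> carrier_mat (2 ^ n) (2 ^ n)"
    using Cons.prems circuit_op_unit gate_op_unit mat_units_carrier by auto
  have Q: "gate_act g P \<in> words n" using Cons.prems gate_act_words by simp
  note w = word_mat_carrier[OF Cons.prems(2)] word_mat_carrier[OF Q]
    word_mat_carrier[OF circ_act_words[OF Q, of gs]]
  have "?A * ?G * word_mat P = ?A * (?G * word_mat P)"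
    using assoc_mult_mat[OF c w(1)] .
  also have "?G * word_mat P = word_mat (gate_act g P) * ?G"
    using gate_op_word_mat[of ps g c] Cons.prems P by simp
  also have "?A * (word_mat (gate_act g P) * ?G) = ?A * word_mat (gate_act g P) * ?G"
    using assoc_mult_mat[OF c(1) w(2) c(2)] by simp
  also have "?A * word_mat (gate_act g P) = word_mat (circ_act gs (gate_act g P)) * ?A"
    using Cons Q by simp
  also have "\<dots> * ?G = word_mat (circ_act gs (gate_act g P)) * (?A * ?G)"
    using assoc_mult_mat[OF w(3) c] .
  finally show ?case by simp
qed

lemma circuit_op_conj:
  "valid_circ n gs \<Longrightarrow> P \<in> words n \<Longrightarrow> circuit_op n gs \<bullet>\<^sub>C word_mat P = word_mat (circ_act gs P)"
  by (intro conj_act_eq[OF circuit_op_unit] circuit_op_word_mat word_mat_carrier circ_act_words)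

lemma gate_op_clifford:
  assumes "valid_gate n g"
  shows "(n, gate_op n g) \<in> clifford"
proof (cases g)
  case (Had q)
  then have "q - 1 + (1 + (n - q)) = n" using assms by simp
  then show ?thesis
    using clifford.tensor[OF clifford.ident[of "q - 1"] clifford.tensor[OF clifford.H clifford.ident[of "n - q"]]]
      Had by simp
next
  case (Phase q)
  then have "q - 1 + (1 + (n - q)) = n" using assms by simp
  then show ?thesis
    using clifford.tensor[OF clifford.ident[of "q - 1"] clifford.tensor[OF clifford.S clifford.ident[of "n - q"]]]
      Phase by simp
next
  case (CZ q)
  then have "1 \<le> q" "q + 1 \<le> n" using assms by auto
  then have "q - 1 + (2 + (n - (q + 1))) = n" by arith
  then show ?thesis
    using clifford.tensor[OF clifford.ident[of "q - 1"] clifford.tensor[OF clifford.Zc clifford.ident[of "n - (q + 1)"]]]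
    unfolding CZ gate_op.simps by metis
next
  case Omega
  then show ?thesis
    using clifford.tensor[OF clifford.omega clifford.ident[of n]] by (simp add: tensor_mat_smult)
qed

lemma circuit_op_Clifford: "valid_circ n gs \<Longrightarrow> circuit_op n gs \<in> Clifford n"
  unfolding Clifford_def
  by (induction gs) (auto intro: clifford.ident clifford.comp gate_op_clifford)

section \<open>Scalar-fixing automorphisms of the group of words\<close>

definition word_aut :: "nat \<Rightarrow> (pauli_word \<Rightarrow> pauli_word) \<Rightarrow> bool" where
  "word_aut n \<Phi> \<longleftrightarrow> bij_betw \<Phi> (words n) (words n) \<and>
     (\<forall>P\<in>words n. \<forall>Q\<in>words n. \<Phi> (word_mult P Q) = word_mult (\<Phi> P) (\<Phi> Q)) \<and>
     (\<forall>c\<in>pauli_scalars. \<Phi> (c, replicate n PI) = (c, replicate n PI))"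

lemma finite_words: "finite (words n)"
proof -
  have "(UNIV :: pauli_letter set) = {PI, PX, PY, PZ}"
    using pauli_letter.exhaust by blast
  then have "finite (UNIV :: pauli_letter set)" by (metis finite.emptyI finite_insert)
  then have "finite {ps :: pauli_letter list. length ps = n}"
    using finite_lists_length_eq[of UNIV n] by simp
  then show ?thesis by (simp add: words_def pauli_scalars_def)
qed

text \<open>There are only finitely many words, so an injective map of \<open>words n\<close> into
  itself is onto.\<close>

lemma word_autI:
  assumes "\<And>P. P \<in> words n \<Longrightarrow> \<Phi> P \<in> words n" "inj_on \<Phi> (words n)"
    "\<And>P Q. P \<in> words n \<Longrightarrow> Q \<in> words n \<Longrightarrow> \<Phi> (word_mult P Q) = word_mult (\<Phi> P) (\<Phi> Q)"
    "\<And>c. c \<in> pauli_scalars \<Longrightarrow> \<Phi> (c, replicate n PI) = (c, replicate n PI)"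
  shows "word_aut n \<Phi>"
proof -
  have "\<Phi> ` words n = words n"
    using assms(1,2) finite_words by (intro endo_inj_surj) auto
  then show ?thesis using assms by (simp add: word_aut_def bij_betw_def)
qed

lemma word_aut_inv:
  assumes "word_aut n \<Phi>"
  shows "word_aut n (inv_into (words n) \<Phi>)"
proof -
  let ?i = "inv_into (words n) \<Phi>"
  have bij: "bij_betw \<Phi> (words n) (words n)"
    and hom: "\<And>P Q. P \<in> words n \<Longrightarrow> Q \<in> words n \<Longrightarrow> \<Phi> (word_mult P Q) = word_mult (\<Phi> P) (\<Phi> Q)"
    and sc: "\<And>c. c \<in> pauli_scalars \<Longrightarrow> \<Phi> (c, replicate n PI) = (c, replicate n PI)"
    using assms by (auto simp: word_aut_def)
  have bij': "bij_betw ?i (words n) (words n)" by (rule bij_betw_inv_into[OF bij])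
  have eqI: "?i Q = P" if "P \<in> words n" "\<Phi> P = Q" for P Q
    using that bij by (metis bij_betw_inv_into_left)
  have "?i (word_mult P Q) = word_mult (?i P) (?i Q)" if PQ: "P \<in> words n" "Q \<in> words n" for P Q
  proof (rule eqI)
    have i: "?i P \<in> words n" "?i Q \<in> words n" using PQ bij' by (auto dest: bij_betwE)
    then show "word_mult (?i P) (?i Q) \<in> words n" by (rule word_mult_closed)
    show "\<Phi> (word_mult (?i P) (?i Q)) = word_mult P Q"
      using hom[OF i] PQ bij by (simp add: bij_betw_inv_into_right)
  qed
  moreover have "?i (c, replicate n PI) = (c, replicate n PI)" if "c \<in> pauli_scalars" for c
    using that by (intro eqI word_one_in sc)
  ultimately show ?thesis using bij' by (simp add: word_aut_def)
qed

lemma word_aut_comp: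
  assumes "word_aut n \<Phi>" "word_aut n \<Psi>"
  shows "word_aut n (\<Phi> \<circ> \<Psi>)"
proof -
  have "\<And>P. P \<in> words n \<Longrightarrow> \<Psi> P \<in> words n"
    using assms(2) by (auto simp: word_aut_def dest: bij_betwE)
  then show ?thesis using assms by (auto simp: word_aut_def intro: bij_betw_trans)
qed

lemma gate_act_scalar: "valid_gate n g \<Longrightarrow> gate_act g (c, replicate n PI) = (c, replicate n PI)"
  by (cases g) (auto simp: cz_sign_def cz_letter_def list_update_same_conv doubleton_eq_iff)

lemma circ_act_scalar: "valid_circ n gs \<Longrightarrow> circ_act gs (c, replicate n PI) = (c, replicate n PI)"
  by (induction gs) (simp_all add: gate_act_scalar)

text \<open>The circuit operator intertwines each word with its image. Cancelling this invertible
  operator gives both injectivity and multiplicativity, with no case analysis on letters.\<close>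

lemma circ_act_aut:
  assumes "valid_circ n gs"
  shows "word_aut n (circ_act gs)"
proof (rule word_autI)
  let ?U = "circuit_op n gs"
  have U: "?U \<in> mat_units (2 ^ n)" using assms by (rule circuit_op_unit)
  note Uc = mat_units_carrier[OF U]
  note wc = word_mat_carrier
  note act = circuit_op_word_mat[OF assms]
  show "inj_on (circ_act gs) (words n)"
  proof (rule inj_onI)
    fix P Q assume PQ: "P \<in> words n" "Q \<in> words n" "circ_act gs P = circ_act gs Q"
    then have "?U * word_mat P = ?U * word_mat Q" by (simp add: act)
    then have "word_mat P = word_mat Q" using mat_units_cancel(1)[OF U wc wc] PQ by blast
    then show "P = Q" using word_mat_inj PQ by (auto dest: inj_onD)
  qed
  fix P Q assume PQ: "P \<in> words n" "Q \<in> words n"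
  note aPQ = circ_act_words[OF PQ(1), of gs] circ_act_words[OF PQ(2), of gs]
  have "word_mat (circ_act gs (word_mult P Q)) * ?U = ?U * (word_mat P * word_mat Q)"
    using PQ by (simp add: act word_mult_closed word_mat_mult)
  also have "\<dots> = ?U * word_mat P * word_mat Q"
    by (rule assoc_mult_mat[OF Uc wc[OF PQ(1)] wc[OF PQ(2)], symmetric])
  also have "\<dots> = word_mat (circ_act gs P) * ?U * word_mat Q" by (simp add: act PQ)
  also have "\<dots> = word_mat (circ_act gs P) * (?U * word_mat Q)"
    by (rule assoc_mult_mat[OF wc[OF aPQ(1)] Uc wc[OF PQ(2)]])
  also have "\<dots> = word_mat (circ_act gs P) * (word_mat (circ_act gs Q) * ?U)" by (simp add: act PQ)
  also have "\<dots> = word_mat (circ_act gs P) * word_mat (circ_act gs Q) * ?U"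
    by (rule assoc_mult_mat[OF wc[OF aPQ(1)] wc[OF aPQ(2)] Uc, symmetric])
  also have "\<dots> = word_mat (word_mult (circ_act gs P) (circ_act gs Q)) * ?U"
    using aPQ by (simp add: word_mat_mult)
  finally have "word_mat (circ_act gs (word_mult P Q)) = word_mat (word_mult (circ_act gs P) (circ_act gs Q))"
    using mat_units_cancel(2)[OF U wc wc] PQ aPQ by (meson circ_act_words word_mult_closed)
  then show "circ_act gs (word_mult P Q) = word_mult (circ_act gs P) (circ_act gs Q)"
    using word_mat_inj PQ aPQ by (meson inj_onD circ_act_words word_mult_closed)
qed (use assms circ_act_words circ_act_scalar in auto)

subsection \<open>Preimages under normal circuits\<close>

text \<open>Isolates the qubits that a named gate touches, \<open>us\<close> and \<open>vs\<close>
  being the letters above and below them. With \<open>us = []\<close> and \<open>vs = [PI]\<close>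
  it is also the inclusion of the Pauli group on n qubits into that on n + 1.\<close>

definition embed :: "pauli_letter list \<Rightarrow> pauli_letter list \<Rightarrow> pauli_word \<Rightarrow> pauli_word" where
  "embed us vs P = (fst P, us @ snd P @ vs)"

lemma embed_simp [simp]: "embed us vs (c, ps) = (c, us @ ps @ vs)"
  by (simp add: embed_def)

lemma gate_act_shift:
  assumes "valid_gate (length ps) g"
  shows "gate_act (shift_gate (length us) g) (embed us vs (c, ps)) = embed us vs (gate_act g (c, ps))"
proof (cases g)
  case (Had q)
  then obtain r where "q = Suc r" "r < length ps" using assms by (cases q) auto
  then show ?thesis using Had by (simp add: nth_append list_update_append)
next
  case (Phase q)
  then obtain r where "q = Suc r" "r < length ps" using assms by (cases q) auto
  then show ?thesis using Phase by (simp add: nth_append list_update_append)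
next
  case (CZ q)
  then obtain r where "q = Suc r" "Suc r < length ps" using assms by (cases q) auto
  then show ?thesis using CZ by (simp add: nth_append list_update_append)
qed simp

lemma gate_act_length: "length (snd (gate_act g P)) = length (snd P)"
  by (cases P; cases g) auto

lemma circ_act_at_qubit:
  "valid_circ (length (snd P)) gs \<Longrightarrow> q = Suc (length us) \<Longrightarrow>
   circ_act (at_qubit q gs) (embed us vs P) = embed us vs (circ_act gs P)"
proof (induction gs arbitrary: P)
  case (Cons g gs)
  have "gate_act (shift_gate (length us) g) (embed us vs P) = embed us vs (gate_act g P)"
    using gate_act_shift[of "snd P" g us vs "fst P"] Cons.prems by simp
  then show ?case
    using Cons.IH[of "gate_act g P"] Cons.prems by (simp add: at_qubit_def gate_act_length)
qed (simp add: at_qubit_def)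

lemma shift_gate_0 [simp]: "shift_gate 0 g = g"
  by (cases g) auto

text \<open>The case of shift zero: a circuit on the top qubits leaves the lower letters alone. This
  is how later layers of a normal circuit treat the last qubit.\<close>

lemma circ_act_extend:
  "valid_circ (length ps) gs \<Longrightarrow> circ_act gs (c, ps @ vs) = embed [] vs (circ_act gs (c, ps))"
  using circ_act_at_qubit[of "(c, ps)" gs 1 "[]" vs] by (simp add: at_qubit_def map_idI)

lemma valid_circ_at_qubit:
  assumes "valid_circ k gs" "1 \<le> q" "q - 1 + k \<le> n"
  shows "valid_circ n (at_qubit q gs)"
proof -
  have "valid_gate n (shift_gate (q - 1) g)" if "valid_gate k g" for g
    using that assms(2,3) by (cases g) auto
  then show ?thesis using assms(1) by (auto simp: at_qubit_def list_all_iff)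
qed

section \<open>Preimages of letters under the named gates\<close>

fun A_letter :: "A_index \<Rightarrow> pauli_letter" where
  "A_letter A1 = PZ"
| "A_letter A2 = PX"
| "A_letter A3 = PY"

text \<open>\<open>B_letter j\<close> is the letter which, when placed above a Z, lets
  \<open>B_circ j\<close> turn the pair into Z \<otimes> I. Every letter occurs for exactly one
  index.\<close>

fun B_letter :: "B_index \<Rightarrow> pauli_letter" where
  "B_letter B1 = PI"
| "B_letter B2 = PX"
| "B_letter B3 = PY"
| "B_letter B4 = PZ"

fun C_sign :: "C_index \<Rightarrow> complex" where
  "C_sign C1 = 1"
| "C_sign C2 = -1"

text \<open>\<open>D_letter l\<close> is the letter below an X or Y that \<open>D_circ l\<close>
  clears while moving the X or Y down one qubit. Again every letter occurs for exactly one
  index.\<close>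

fun D_letter :: "D_index \<Rightarrow> pauli_letter" where
  "D_letter D1 = PI"
| "D_letter D2 = PX"
| "D_letter D3 = PY"
| "D_letter D4 = PZ"

text \<open>The signed letter that \<open>E_circ h\<close> sends to X. The four values are
  \<plusminus>X and \<plusminus>Y, the self-inverse one-qubit operators anticommuting with
  Z.\<close>

fun E_letter :: "E_index \<Rightarrow> complex \<times> pauli_letter" where
  "E_letter E1 = (1, PX)"
| "E_letter E2 = (-1, PY)"
| "E_letter E3 = (-1, PX)"
| "E_letter E4 = (1, PY)"

lemmas gate_act_eval = cz_letter_def cz_sign_def doubleton_eq_iff

lemma A_circ_act: "circ_act (A_circ i) (c, [A_letter i]) = (c, [PZ])"
  by (cases i) (simp_all add: gate_act_eval)

lemma B_circ_act: "circ_act (B_circ j) (c, [B_letter j, PZ]) = (c, [PZ, PI])"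
  by (cases j) (simp_all add: gate_act_eval)

lemma C_circ_act: "circ_act (C_circ k) (c, [PZ]) = (c * C_sign k, [PZ])"
  by (cases k) (simp_all add: gate_act_eval)

text \<open>The same gate transports both X and Y, and no sign arises. Hence the first letter of a
  word and its sign reach the last qubit unchanged, where the gate E settles them.\<close>

lemma D_circ_act: "x = PX \<or> x = PY \<Longrightarrow> circ_act (D_circ l) (c, [x, D_letter l]) = (c, [PI, x])"
  by (cases l; elim disjE) (simp_all add: gate_act_eval)

lemma D_circ_act_Z: "circ_act (D_circ l) (c, [PZ, PI]) = (c, [PI, PZ])"
  by (cases l) (simp_all add: gate_act_eval)

lemma E_circ_act: "circ_act (E_circ h) (fst (E_letter h), [snd (E_letter h)]) = (1, [PX])"
  by (cases h) (simp_all add: gate_act_eval)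

lemma E_circ_act_Z: "circ_act (E_circ h) (c, [PZ]) = (c, [PZ])"
  by (cases h) (simp_all add: gate_act_eval)

lemma valid_named_circs:
  "valid_circ 1 (A_circ i)" "valid_circ 2 (B_circ j)" "valid_circ 1 (C_circ k)"
  "valid_circ 2 (D_circ l)" "valid_circ 1 (E_circ h)"
proof -
  show "valid_circ 1 (A_circ i)" by (cases i) auto
  show "valid_circ 2 (B_circ j)" by (cases j) auto
  show "valid_circ 1 (C_circ k)" by (cases k) auto
  show "valid_circ 2 (D_circ l)" by (cases l) auto
  show "valid_circ 1 (E_circ h)" by (cases h) auto
qed

text \<open>Each gate moves the Z up one qubit and leaves I behind. The gates consume the letters
  from the bottom, hence the reversal; \<open>vs\<close> is general because the I left behind joins
  the lower letters in the induction.\<close>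

lemma B_ladder_act:
  "circ_act (concat (map (\<lambda>t. at_qubit (Suc (length js) - t) (B_circ (js ! (t - 1)))) [1..<Suc (length js)]))
     (c, rev (map B_letter js) @ PZ # vs) = (c, PZ # replicate (length js) PI @ vs)"
proof (induction js arbitrary: vs)
  case (Cons j js)
  let ?k = "length js"
  \<comment> \<open>Index 1 is the gate on the lowest pair. Shifting the remaining indices down by
    one gives precisely the ladder for \<open>js\<close>.\<close>
  have upt: "[1..<Suc (length (j # js))] = 1 # map Suc [1..<Suc ?k]"
    by (simp add: upt_conv_Cons map_Suc_upt del: upt_Suc)
  have tail: "map ((\<lambda>t. at_qubit (Suc (length (j # js)) - t) (B_circ ((j # js) ! (t - 1)))) \<circ> Suc) [1..<Suc ?k] =
      map (\<lambda>t. at_qubit (Suc ?k - t) (B_circ (js ! (t - 1)))) [1..<Suc ?k]"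
    by (rule map_cong) (auto simp: nth_Cons' simp del: upt_Suc)
  have "circ_act (at_qubit (Suc ?k) (B_circ j)) (embed (rev (map B_letter js)) vs (c, [B_letter j, PZ])) =
      embed (rev (map B_letter js)) vs (c, [PZ, PI])"
    using valid_named_circs(2) by (subst circ_act_at_qubit) (simp_all add: B_circ_act numeral_2_eq_2)
  then show ?case
    unfolding upt list.map concat.simps map_map tail circ_act_append
    using Cons.IH[of "PI # vs"] by (simp add: replicate_app_Cons_same del: upt_Suc)
qed simp

text \<open>Here the letter \<open>x\<close> travels downwards and \<open>us\<close> collects the
  letters already passed. The action of a single gate is left as a premise so that the lemma serves
  X and Y as well as Z.\<close>

lemma D_ladder_act:
  "length ms = length ls \<Longrightarrow>
   (\<And>i. i < length ls \<Longrightarrow> circ_act (D_circ (ls ! i)) (c, [x, ms ! i]) = (c, [PI, x])) \<Longrightarrow>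
   circ_act (concat (map (\<lambda>t. at_qubit (t + length us) (D_circ (ls ! (t - 1)))) [1..<Suc (length ls)]))
     (c, us @ x # ms) = (c, us @ replicate (length ls) PI @ [x])"
proof (induction ls arbitrary: us ms)
  case (Cons l ls)
  obtain y ms' where ms: "ms = y # ms'" "length ms' = length ls"
    using Cons.prems(1) by (cases ms) auto
  let ?k = "length ls"
  have upt: "[1..<Suc (length (l # ls))] = 1 # map Suc [1..<Suc ?k]"
    by (simp add: upt_conv_Cons map_Suc_upt del: upt_Suc)
  have tail: "map ((\<lambda>t. at_qubit (t + length us) (D_circ ((l # ls) ! (t - 1)))) \<circ> Suc) [1..<Suc ?k] =
      map (\<lambda>t. at_qubit (t + length (us @ [PI])) (D_circ (ls ! (t - 1)))) [1..<Suc ?k]"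
    by (rule map_cong) (auto simp: nth_Cons' simp del: upt_Suc)
  have step: "circ_act (D_circ l) (c, [x, y]) = (c, [PI, x])"
    using Cons.prems(2)[of 0] ms by simp
  have "circ_act (at_qubit (1 + length us) (D_circ l)) (embed us ms' (c, [x, y])) = embed us ms' (c, [PI, x])"
    using valid_named_circs(4) by (subst circ_act_at_qubit) (simp_all add: step numeral_2_eq_2)
  moreover have "circ_act (D_circ (ls ! i)) (c, [x, ms' ! i]) = (c, [PI, x])" if "i < ?k" for i
    using Cons.prems(2)[of "Suc i"] ms that by simp
  note Cons.IH[OF ms(2) this, of "us @ [PI]"]
  ultimately show ?case
    unfolding upt list.map concat.simps map_map tail circ_act_append
    by (simp add: ms del: upt_Suc)
qed simp

text \<open>
  The preimages of \<open>Z \<otimes> I \<otimes> \<dots> \<otimes> I\<close> and of \<open>I \<otimes> \<dots> \<otimes> I \<otimes> X\<close>. The list \<open>Zj L\<close> is reversed because its first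
  entry acts on the lowest qubits.
\<close>

definition Z_word :: "nat \<Rightarrow> Z_params \<Rightarrow> pauli_word" where
  "Z_word n L = (C_sign (Zk L), rev (map B_letter (Zj L)) @ A_letter (Zi L) # replicate (n - Zm L) PI)"

definition X_word :: "X_params \<Rightarrow> pauli_word" where
  "X_word M = (fst (E_letter (Xh M)), snd (E_letter (Xh M)) # map D_letter (Xl M))"

lemma Z_circ_act:
  assumes "Z_normal (Suc n) L"
  shows "circ_act (Z_circ L) (Z_word (Suc n) L) = (1, PZ # replicate n PI)"
proof -
  obtain m i js k where L: "L = Z_params m i js k" by (cases L)
  have m: "m = Suc (length js)" "m \<le> Suc n" using assms L by (auto simp: Z_normal_def)
  let ?c = "C_sign k" and ?vs = "replicate (n - length js) PI"
  have "circ_act (at_qubit m (A_circ i)) (embed (rev (map B_letter js)) ?vs (?c, [A_letter i])) =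
      embed (rev (map B_letter js)) ?vs (?c, [PZ])"
    using valid_named_circs(1) by (subst circ_act_at_qubit) (simp_all add: A_circ_act m)
  \<comment> \<open>The gate C multiplies the sign \<open>C_sign k\<close> by itself, which gives
    1.\<close>
  moreover have "circ_act (at_qubit 1 (C_circ k)) (embed [] (replicate n PI) (?c, [PZ])) =
      embed [] (replicate n PI) (1, [PZ])"
    using valid_named_circs(3)
    by (subst circ_act_at_qubit) (simp_all add: C_circ_act, cases k, simp_all)
  moreover have "replicate (length js) PI @ ?vs = replicate n PI"
    using m by (simp flip: replicate_add)
  ultimately show ?thesis
    using B_ladder_act[of js ?c ?vs] by (simp add: L Z_circ_def Z_word_def m(1) del: upt_Suc)
qed

text \<open>The first claim depends on the parameters, the second does not: the gates D carry Z down
  whatever their index, and the gate E commutes with Z. Hence the preimage of Z on the last qubit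
  under a layer is governed by its Z-normal part alone.\<close>

lemma X_circ_act:
  assumes "X_normal (Suc n) M"
  shows "circ_act (X_circ (Suc n) M) (X_word M) = (1, replicate n PI @ [PX])"
    and "circ_act (X_circ (Suc n) M) (1, PZ # replicate n PI) = (1, replicate n PI @ [PZ])"
proof -
  obtain ls h where M: "M = X_params ls h" by (cases M)
  have n: "n = length ls" using assms M by (auto simp: X_normal_def)
  let ?c = "fst (E_letter h)" and ?x = "snd (E_letter h)"
  have "?x = PX \<or> ?x = PY" by (cases h) auto
  then have *: "circ_act (D_circ (ls ! i)) (?c, [?x, map D_letter ls ! i]) = (?c, [PI, ?x])"
    if "i < length ls" for i
    using that by (simp add: D_circ_act)
  have "circ_act (at_qubit (Suc n) (E_circ h)) (embed (replicate n PI) [] (?c, [?x])) =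
      embed (replicate n PI) [] (1, [PX])"
    using valid_named_circs(5) by (subst circ_act_at_qubit) (simp_all add: E_circ_act)
  then show "circ_act (X_circ (Suc n) M) (X_word M) = (1, replicate n PI @ [PX])"
    using D_ladder_act[OF length_map *, of "[]"] by (simp add: M X_circ_def X_word_def n del: upt_Suc)
  have **: "circ_act (D_circ (ls ! i)) (1, [PZ, replicate n PI ! i]) = (1, [PI, PZ])"
    if "i < length ls" for i
    using that n by (simp add: D_circ_act_Z)
  have "circ_act (at_qubit (Suc n) (E_circ h)) (embed (replicate n PI) [] (1, [PZ])) =
      embed (replicate n PI) [] (1, [PZ])"
    using valid_named_circs(5) by (subst circ_act_at_qubit) (simp_all add: E_circ_act_Z)
  then show "circ_act (X_circ (Suc n) M) (1, PZ # replicate n PI) = (1, replicate n PI @ [PZ])"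
    using D_ladder_act[OF _ **, of "[]"] by (simp add: M X_circ_def n del: upt_Suc)
qed

lemma ex_map_eq: "surj f \<Longrightarrow> \<exists>xs. map f xs = ys"
  by (metis ex_map_conv surjD)

lemma B_letter_bij: "inj B_letter" "surj B_letter"
proof -
  show "inj B_letter"
  proof (rule injI)
    fix i j assume "B_letter i = B_letter j" then show "i = j" by (cases i; cases j) auto
  qed
  show "surj B_letter" unfolding surj_def by (metis B_letter.simps pauli_letter.exhaust)
qed

lemma D_letter_bij: "inj D_letter" "surj D_letter"
proof -
  show "inj D_letter"
  proof (rule injI)
    fix i j assume "D_letter i = D_letter j" then show "i = j" by (cases i; cases j) auto
  qed
  show "surj D_letter" unfolding surj_def by (metis D_letter.simps pauli_letter.exhaust)
qed

lemma Z_word_inj: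
  assumes "Z_normal n L" "Z_normal n L'" "Z_word n L = Z_word n L'"
  shows "L = L'"
proof -
  obtain m i js k m' i' js' k' where L: "L = Z_params m i js k" "L' = Z_params m' i' js' k'"
    by (cases L; cases L')
  \<comment> \<open>\<open>A_letter\<close> is never I, so stripping the trailing identities ends
    exactly at the letter belonging to A; the letters before it then give the indices of B, and
    their number gives \<open>m\<close>.\<close>
  have drop: "dropWhile (\<lambda>p. p = PI) (rev (rev (map B_letter js) @ A_letter i # replicate r PI)) =
      A_letter i # map B_letter js" for i js r
    by (cases i) (simp_all add: dropWhile_append)
  have "A_letter i # map B_letter js = A_letter i' # map B_letter js'"
    using assms(3) drop[of js i "n - m"] drop[of js' i' "n - m'"] by (simp add: Z_word_def L)
  then have "A_letter i = A_letter i'" "js = js'"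
    using B_letter_bij by (auto simp: inj_map_eq_map)
  moreover from this have "i = i'" by (cases i; cases i') auto
  moreover have "C_sign k = C_sign k'" using assms(3) by (simp add: Z_word_def L)
  then have "k = k'" by (cases k; cases k') auto
  ultimately show ?thesis using assms(1,2) by (auto simp: L Z_normal_def)
qed

text \<open>Split the word at its last letter other than I: that letter chooses A, the letters
  before it choose the gates B, and the sign chooses C.\<close>

lemma Z_word_surj:
  assumes "c = 1 \<or> c = -1" "length ps = n" "ps \<noteq> replicate n PI"
  shows "\<exists>L. Z_normal n L \<and> Z_word n L = (c, ps)"
proof -
  have "\<exists>p\<in>set ps. p \<noteq> PI" using assms(2,3) replicate_eqI[of ps n PI] by blast
  then obtain qs p rs where ps: "ps = qs @ p # rs" "p \<noteq> PI" "\<forall>r\<in>set rs. r = PI"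
    using split_list_last_prop[of ps "\<lambda>p. p \<noteq> PI"] by auto
  have rs: "rs = replicate (length rs) PI" using ps(3) by (intro replicate_eqI) auto
  obtain js where js: "map B_letter js = rev qs" using ex_map_eq[OF B_letter_bij(2)] by blast
  have lj: "length js = length qs" using arg_cong[OF js, of length] by simp
  obtain i where i: "A_letter i = p" using ps(2) by (metis A_letter.simps pauli_letter.exhaust)
  obtain k where k: "C_sign k = c" using assms(1) by (metis C_sign.simps)
  have n: "n = length qs + Suc (length rs)" using ps(1) assms(2) by simp
  have "Z_normal n (Z_params (Suc (length js)) i js k)"
    by (simp add: Z_normal_def n lj)
  moreover have "Z_word n (Z_params (Suc (length js)) i js k) = (c, ps)"
    using ps(1) rs by (simp add: Z_word_def js i k n lj)
  ultimately show ?thesis by blast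
qed

lemma X_word_inj:
  assumes "X_word M = X_word M'"
  shows "M = M'"
proof -
  obtain ls h ls' h' where M: "M = X_params ls h" "M' = X_params ls' h'"
    by (cases M; cases M')
  have "ls = ls'" "E_letter h = E_letter h'"
    using assms D_letter_bij by (auto simp: X_word_def M inj_map_eq_map prod_eq_iff)
  moreover from this(2) have "h = h'" by (cases h; cases h') auto
  ultimately show ?thesis by (simp add: M)
qed

lemma X_word_surj:
  assumes "c = 1 \<or> c = -1" "p = PX \<or> p = PY" "length qs = n"
  shows "\<exists>M. X_normal (Suc n) M \<and> X_word M = (c, p # qs)"
proof -
  obtain ls where ls: "map D_letter ls = qs" using ex_map_eq[OF D_letter_bij(2)] by blast
  obtain h where h: "E_letter h = (c, p)" using assms(1,2) by (metis E_letter.simps)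
  have "X_normal (Suc n) (X_params ls h)" using ls assms(3) by (auto simp: X_normal_def)
  moreover have "X_word (X_params ls h) = (c, p # qs)" by (simp add: X_word_def ls h)
  ultimately show ?thesis by blast
qed

subsection \<open>Automorphisms and normal circuits\<close>

lemma valid_circ_concat: "valid_circ n (concat gss) \<longleftrightarrow> (\<forall>gs\<in>set gss. valid_circ n gs)"
  by (auto simp: list_all_iff)

lemma Z_circ_valid: "Z_normal n L \<Longrightarrow> valid_circ n (Z_circ L)"
  by (auto simp: Z_normal_def Z_circ_def valid_circ_concat
      intro!: valid_named_circs[THEN valid_circ_at_qubit])

lemma X_circ_valid: "X_normal n M \<Longrightarrow> valid_circ n (X_circ n M)"
  by (auto simp: X_normal_def X_circ_def valid_circ_concat
      intro!: valid_named_circs[THEN valid_circ_at_qubit])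

text \<open>Since \<open>Suc n - Suc t = n - t\<close>, removing the first layer leaves a normal
  circuit on one qubit fewer. This is the recursion behind both inductions on the number of
  qubits.\<close>

lemma normal_circ_Cons:
  "normal_circ (Suc n) (Normal_circuit ((L, M) # ls) p) =
   Z_circ L @ X_circ (Suc n) M @ normal_circ n (Normal_circuit ls p)"
proof -
  have upt: "[0..<Suc n] = 0 # map Suc [0..<n]"
    by (simp add: upt_conv_Cons map_Suc_upt del: upt_Suc)
  show ?thesis unfolding normal_circ_def upt by (simp add: comp_def)
qed

lemma is_normal_Cons:
  "is_normal (Suc n) (Normal_circuit ((L, M) # ls) p) \<longleftrightarrow>
   Z_normal (Suc n) L \<and> X_normal (Suc n) M \<and> is_normal n (Normal_circuit ls p)"
  by (auto simp: is_normal_def All_less_Suc2)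

lemma valid_gate_mono: "valid_gate n g \<Longrightarrow> n \<le> n' \<Longrightarrow> valid_gate n' g"
  by (cases g) auto

lemma valid_circ_mono: "valid_circ n gs \<Longrightarrow> n \<le> n' \<Longrightarrow> valid_circ n' gs"
  by (auto simp: list_all_iff intro: valid_gate_mono)

lemma is_normal_cases:
  assumes "is_normal (Suc n) C"
  obtains L M ls p where "C = Normal_circuit ((L, M) # ls) p"
    "Z_normal (Suc n) L" "X_normal (Suc n) M" "is_normal n (Normal_circuit ls p)"
proof -
  obtain lss p where C: "C = Normal_circuit lss p" by (cases C)
  then have "length lss = Suc n" using assms by (simp add: is_normal_def)
  then obtain L M ls where "lss = (L, M) # ls" by (cases lss) auto
  then show ?thesis using that assms C is_normal_Cons by blast
qed

lemma normal_circ_valid: "is_normal n C \<Longrightarrow> valid_circ n (normal_circ n C)"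
proof (induction n arbitrary: C)
  case 0
  then show ?case by (simp add: normal_circ_def list_all_iff)
next
  case (Suc n)
  from Suc.prems obtain L M ls p where C: "C = Normal_circuit ((L, M) # ls) p"
    "Z_normal (Suc n) L" "X_normal (Suc n) M" "is_normal n (Normal_circuit ls p)"
    by (rule is_normal_cases)
  show ?case
    using Z_circ_valid[OF C(2)] X_circ_valid[OF C(3)] valid_circ_mono[OF Suc.IH[OF C(4)]]
    by (simp add: C(1) normal_circ_Cons)
qed

section \<open>Commutation relations and the Pauli operators on the last qubit\<close>

lemma anticommute_letter:
  assumes "letter_phase q PZ = - letter_phase PZ q"
  shows "q = PX \<or> q = PY"
  using assms by (cases q) (auto simp: complex_eq_iff)

text \<open>Products of letters commute up to phase, so commuting means equal phases. X and Z
  generate all letters up to scalars, so only I commutes with both.\<close>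

lemma commute_letter:
  assumes "letter_phase q PX = letter_phase PX q" "letter_phase q PZ = letter_phase PZ q"
  shows "q = PI"
  using assms by (cases q) (auto simp: complex_eq_iff)

lemma letter_PI [simp]:
  "letter_mult p PI = p" "letter_phase p PI = 1" "letter_phase PI p = 1"
  by (cases p; simp)+

lemma map2_replicate_PI [simp]:
  "length ps = n \<Longrightarrow> map2 letter_mult ps (replicate n PI) = ps"
  "length ps = n \<Longrightarrow> map2 letter_mult (replicate n PI) ps = ps"
  "length ps = n \<Longrightarrow> prod_list (map2 letter_phase ps (replicate n PI)) = 1"
  "length ps = n \<Longrightarrow> prod_list (map2 letter_phase (replicate n PI) ps) = 1"
  by (induction ps arbitrary: n; force)+

lemma word_mult_append:
  assumes "length ps = length qs"
  shows "word_mult (c, ps @ [p]) (d, qs @ [q]) =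
    (fst (word_mult (c, ps) (d, qs)) * letter_phase p q,
     snd (word_mult (c, ps) (d, qs)) @ [letter_mult p q])"
  using assms by simp

lemma word_aut_closed: "word_aut n \<Phi> \<Longrightarrow> P \<in> words n \<Longrightarrow> \<Phi> P \<in> words n"
  and word_aut_mult: "word_aut n \<Phi> \<Longrightarrow> P \<in> words n \<Longrightarrow> Q \<in> words n \<Longrightarrow>
    \<Phi> (word_mult P Q) = word_mult (\<Phi> P) (\<Phi> Q)"
  and word_aut_scalar: "word_aut n \<Phi> \<Longrightarrow> c \<in> pauli_scalars \<Longrightarrow> \<Phi> (c, replicate n PI) = (c, replicate n PI)"
  and word_aut_inj: "word_aut n \<Phi> \<Longrightarrow> P \<in> words n \<Longrightarrow> Q \<in> words n \<Longrightarrow> \<Phi> P = \<Phi> Q \<Longrightarrow> P = Q"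
  by (auto simp: word_aut_def bij_betw_def dest: inj_onD)

lemma word_aut_inv_into:
  assumes "word_aut n \<Phi>" "P \<in> words n"
  shows "\<Phi> (inv_into (words n) \<Phi> P) = P" "inv_into (words n) \<Phi> P \<in> words n"
    "inv_into (words n) \<Phi> (\<Phi> P) = P"
  using assms
  by (auto simp: word_aut_def bij_betw_def inv_into_f_f intro!: f_inv_into_f inv_into_into[of P \<Phi> "words n", simplified])

text \<open>The index counts the qubits above the last one, so this is a word on
  \<open>Suc n\<close> qubits.\<close>

definition last_X :: "nat \<Rightarrow> pauli_word" where
  "last_X n = (1, replicate n PI @ [PX])"

definition last_Z :: "nat \<Rightarrow> pauli_word" where
  "last_Z n = (1, replicate n PI @ [PZ])"

lemma last_words [simp]: "last_X n \<in> words (Suc n)" "last_Z n \<in> words (Suc n)"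
  by (auto simp: last_X_def last_Z_def words_def pauli_scalars_def)

lemma first_Z_in [simp]: "(1, PZ # replicate n PI) \<in> words (Suc n)"
  by (auto simp: words_def pauli_scalars_def)

lemma pauli_scalars_1: "1 \<in> pauli_scalars" "-1 \<in> pauli_scalars" "\<i> \<in> pauli_scalars"
  by (auto simp: pauli_scalars_def)

text \<open>Every letter squares to I with phase 1, so the square of a word is the square of its
  scalar; this rules out \<plusminus>i.\<close>

lemma word_square_sign:
  assumes "P \<in> words n" "word_mult P P = (1, replicate n PI)"
  shows "fst P = 1 \<or> fst P = -1"
proof -
  have "fst P * fst P = 1" using assms word_mult_self[of "fst P" "snd P"] by (metis fst_conv prod.collapse)
  then show ?thesis by (simp add: square_eq_1_iff)
qed

lemma word_mult_square:
  "word_mult (last_X n) (last_X n) = (1, replicate (Suc n) PI)"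
  "word_mult (last_Z n) (last_Z n) = (1, replicate (Suc n) PI)"
  unfolding last_X_def last_Z_def by (subst word_mult_self; simp)+

lemma aut_square:
  assumes "word_aut n \<Phi>" "P \<in> words n" "word_mult P P = (1, replicate n PI)"
  shows "word_mult (\<Phi> P) (\<Phi> P) = (1, replicate n PI)"
  using word_aut_mult[OF assms(1,2,2)] word_aut_scalar[OF assms(1) pauli_scalars_1(1)] assms(3) by simp

text \<open>The sign is written as a central word, so that an automorphism fixing scalars can be
  applied to the whole relation.\<close>

lemma last_anticommute:
  "word_mult (last_X n) (last_Z n) = word_mult (-1, replicate (Suc n) PI) (word_mult (last_Z n) (last_X n))"
proof -
  have "replicate (Suc n) PI = replicate n PI @ [PI]" by (simp add: replicate_append_same)
  then show ?thesis
    unfolding last_X_def last_Z_def by (simp add: word_mult_append del: word_mult.simps replicate_Suc) simp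
qed

text \<open>It will be applied to the inverse of the automorphism to be realized, so that
  \<open>\<Phi> (last_Z n)\<close> and \<open>\<Phi> (last_X n)\<close> are the preimages the layer
  has to match.\<close>

lemma ex_layer:
  assumes aut: "word_aut (Suc n) \<Phi>"
  obtains L M where "Z_normal (Suc n) L" "X_normal (Suc n) M"
    "circ_act (Z_circ L @ X_circ (Suc n) M) (\<Phi> (last_Z n)) = last_Z n"
    "circ_act (Z_circ L @ X_circ (Suc n) M) (\<Phi> (last_X n)) = last_X n"
proof -
  define P where "P = \<Phi> (last_Z n)"
  have P: "P \<in> words (Suc n)" using aut by (simp add: P_def word_aut_closed)
  have "word_mult P P = (1, replicate (Suc n) PI)"
    unfolding P_def by (rule aut_square[OF aut last_words(2) word_mult_square(2)])
  then have cP: "fst P = 1 \<or> fst P = -1" using P by (rule word_square_sign[rotated])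
  \<comment> \<open>Otherwise an injective map fixing the scalars would send the non-scalar
    \<open>last_Z n\<close> to a scalar.\<close>
  have "snd P \<noteq> replicate (Suc n) PI"
  proof
    assume "snd P = replicate (Suc n) PI"
    then have "\<Phi> (last_Z n) = \<Phi> (fst P, replicate (Suc n) PI)" "(fst P, replicate (Suc n) PI) \<in> words (Suc n)"
      using word_aut_scalar[OF aut, of "fst P"] P by (auto simp: P_def words_def prod_eq_iff mem_Times_iff)
    then have "last_Z n = (fst P, replicate (Suc n) PI)"
      using word_aut_inj[OF aut] last_words(2) by blast
    then show False by (simp add: last_Z_def replicate_append_same[symmetric])
  qed
  then obtain L where L: "Z_normal (Suc n) L" "Z_word (Suc n) L = P"
    using Z_word_surj[OF cP, of "snd P" "Suc n"] P by (auto simp: words_def)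
  define \<Psi> where "\<Psi> = circ_act (Z_circ L) \<circ> \<Phi>"
  have aut': "word_aut (Suc n) \<Psi>"
    unfolding \<Psi>_def using aut circ_act_aut Z_circ_valid L(1) by (intro word_aut_comp) auto
  have PZ: "\<Psi> (last_Z n) = (1, PZ # replicate n PI)"
    using Z_circ_act[OF L(1)] L(2) by (simp add: \<Psi>_def P_def)
  obtain d q qs where Q: "\<Psi> (last_X n) = (d, q # qs)" "length qs = n" "d \<in> pauli_scalars"
    using word_aut_closed[OF aut' last_words(1)] by (auto simp: words_def length_Suc_conv)
  have "word_mult (\<Psi> (last_X n)) (\<Psi> (last_X n)) = (1, replicate (Suc n) PI)"
    by (rule aut_square[OF aut' last_words(1) word_mult_square(1)])
  then have d: "d = 1 \<or> d = -1"
    using word_square_sign[OF word_aut_closed[OF aut' last_words(1)]] Q by simp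
  have "word_mult (\<Psi> (last_X n)) (\<Psi> (last_Z n)) =
      word_mult (-1, replicate (Suc n) PI) (word_mult (\<Psi> (last_Z n)) (\<Psi> (last_X n)))"
    using arg_cong[OF last_anticommute[of n], of \<Psi>] pauli_scalars_1
    by (simp add: word_aut_mult[OF aut'] word_aut_scalar[OF aut'] word_mult_closed word_one_in
        del: replicate_Suc word_mult.simps)
  \<comment> \<open>Beyond the first qubit the image of \<open>last_Z n\<close> has only the letter
    I, so the anticommutation is visible in the first letter alone.\<close>
  then have "d * letter_phase q PZ = - (d * letter_phase PZ q)"
    using Q(2) by (simp add: Q(1) PZ)
  then have "d * (letter_phase q PZ + letter_phase PZ q) = 0" by (simp add: algebra_simps)
  then have "letter_phase q PZ = - letter_phase PZ q"
    using pauli_scalars_nonzero[OF Q(3)] by (simp add: eq_neg_iff_add_eq_0)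
  then have "q = PX \<or> q = PY" by (rule anticommute_letter)
  then obtain M where M: "X_normal (Suc n) M" "X_word M = (d, q # qs)"
    using X_word_surj[OF d _ Q(2)] by blast
  show ?thesis
    using that[OF L(1) M(1)] X_circ_act[OF M(1)] PZ Q(1) M(2)
    by (simp add: \<Psi>_def last_X_def last_Z_def)
qed

text \<open>Words ending in I commute with \<open>last_X n\<close> and \<open>last_Z n\<close>. As
  both are fixed, the images commute with them too and must end in I; dropping that letter defines
  the restriction.\<close>

lemma restrict_aut:
  assumes aut: "word_aut (Suc n) \<Psi>" and X: "\<Psi> (last_X n) = last_X n" and Z: "\<Psi> (last_Z n) = last_Z n"
  obtains \<psi> where "word_aut n \<psi>" "\<And>P. P \<in> words n \<Longrightarrow> \<Psi> (embed [] [PI] P) = embed [] [PI] (\<psi> P)"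
proof
  let ?e = "embed [] [PI]"
  define \<psi> where "\<psi> P = (fst (\<Psi> (?e P)), butlast (snd (\<Psi> (?e P))))" for P
  have e: "?e P \<in> words (Suc n)" if "P \<in> words n" for P
    using that by (auto simp: words_def)
  have e_mult: "?e (word_mult P Q) = word_mult (?e P) (?e Q)" if "P \<in> words n" "Q \<in> words n" for P Q
    using that by (auto simp: words_def)
  have e_inj: "?e P = ?e Q \<Longrightarrow> P = Q" for P Q
    by (cases P; cases Q) auto
  have e_scalar: "?e (c, replicate n PI) = (c, replicate (Suc n) PI)" for c
    by (simp add: replicate_append_same)
  show ext: "\<Psi> (?e P) = ?e (\<psi> P)" if P: "P \<in> words n" for P
  proof -
    obtain c ps where cps: "P = (c, ps)" "length ps = n" using P by (auto simp: words_def)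
    obtain d rs where d: "\<Psi> (?e P) = (d, rs)" "length rs = Suc n" "d \<in> pauli_scalars"
      using word_aut_closed[OF aut e[OF P]] by (auto simp: words_def)
    then obtain qs q where rs: "rs = qs @ [q]" "length qs = n" by (metis length_Suc_conv_rev)
    \<comment> \<open>At every position one of the two words has I, so they commute. After applying
      \<open>\<Psi>\<close>, a discrepancy between the two products could come only from the last
      letter.\<close>
    have comm: "letter_phase q p = letter_phase p q"
      if W: "(1, replicate n PI @ [p]) \<in> words (Suc n)" "\<Psi> (1, replicate n PI @ [p]) = (1, replicate n PI @ [p])" for p
    proof -
      have "word_mult (?e P) (1, replicate n PI @ [p]) = word_mult (1, replicate n PI @ [p]) (?e P)"
        using cps by simp
      then have "word_mult (\<Psi> (?e P)) (1, replicate n PI @ [p]) = word_mult (1, replicate n PI @ [p]) (\<Psi> (?e P))"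
        using word_aut_mult[OF aut e[OF P] W(1)] word_aut_mult[OF aut W(1) e[OF P]] W(2) by simp
      then have "d * letter_phase q p = d * letter_phase p q"
        using rs d(1) by simp
      then show ?thesis using pauli_scalars_nonzero[OF d(3)] by simp
    qed
    have "q = PI"
      using comm[of PX] comm[of PZ] X Z last_words[of n]
      by (intro commute_letter) (simp_all add: last_X_def last_Z_def)
    then show ?thesis using d rs by (simp add: \<psi>_def)
  qed
  have closed: "\<psi> P \<in> words n" if "P \<in> words n" for P
    using word_aut_closed[OF aut e[OF that]] unfolding ext[OF that]
    by (cases "\<psi> P") (simp add: words_def)
  show "word_aut n \<psi>"
  proof (rule word_autI)
    show "inj_on \<psi> (words n)"
      using ext e e_inj word_aut_inj[OF aut] by (intro inj_onI) metis
    fix P Q assume PQ: "P \<in> words n" "Q \<in> words n"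
    have "?e (\<psi> (word_mult P Q)) = \<Psi> (word_mult (?e P) (?e Q))"
      using PQ by (simp only: ext[symmetric] e_mult word_mult_closed)
    also have "\<dots> = word_mult (?e (\<psi> P)) (?e (\<psi> Q))"
      using PQ by (simp only: word_aut_mult[OF aut e e] ext)
    also have "\<dots> = ?e (word_mult (\<psi> P) (\<psi> Q))"
      using PQ by (simp only: closed e_mult)
    finally show "\<psi> (word_mult P Q) = word_mult (\<psi> P) (\<psi> Q)" by (rule e_inj)
  next
    fix c assume c: "c \<in> pauli_scalars"
    then have "?e (\<psi> (c, replicate n PI)) = ?e (c, replicate n PI)"
      using ext[OF word_one_in[OF c]] word_aut_scalar[OF aut c] by (simp only: e_scalar)
    then show "\<psi> (c, replicate n PI) = (c, replicate n PI)" by (rule e_inj)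
  qed (rule closed)
qed

text \<open>Each word is an embedded word on n qubits times a letter on the last qubit, and the
  letters there are generated by X, Z and the scalar i.\<close>

lemma word_aut_eqI:
  assumes aut: "word_aut (Suc n) \<Phi>" "word_aut (Suc n) \<Psi>"
    and XZ: "\<Phi> (last_X n) = \<Psi> (last_X n)" "\<Phi> (last_Z n) = \<Psi> (last_Z n)"
    and ext: "\<And>P. P \<in> words n \<Longrightarrow> \<Phi> (embed [] [PI] P) = \<Psi> (embed [] [PI] P)"
    and P: "P \<in> words (Suc n)"
  shows "\<Phi> P = \<Psi> P"
proof -
  let ?w = "\<lambda>p. (1, replicate n PI @ [p])"
  have w: "?w p \<in> words (Suc n)" for p
    by (simp add: words_def pauli_scalars_1)
  have mult: "\<Phi> (word_mult Q R) = \<Psi> (word_mult Q R)"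
    if "Q \<in> words (Suc n)" "R \<in> words (Suc n)" "\<Phi> Q = \<Psi> Q" "\<Phi> R = \<Psi> R" for Q R
    using that by (simp add: word_aut_mult[OF aut(1)] word_aut_mult[OF aut(2)])
  have i: "(\<i>, replicate n PI) \<in> words n" "(1, replicate n PI) \<in> words n"
    by (simp_all add: word_one_in pauli_scalars_1)
  have iw: "embed [] [PI] (\<i>, replicate n PI) \<in> words (Suc n)"
    by (simp add: words_def pauli_scalars_1)
  \<comment> \<open>The relation Y = i X Z, with the scalar i taken from the embedded words, where
    the two maps already agree.\<close>
  have Y: "?w PY = word_mult (embed [] [PI] (\<i>, replicate n PI)) (word_mult (?w PX) (?w PZ))"
    by simp
  have "\<Phi> (?w p) = \<Psi> (?w p)" for p
  proof (cases p)
    case PI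
    then show ?thesis using ext[OF i(2)] by simp
  next
    case PY
    then show ?thesis
      unfolding PY Y
      using XZ ext[OF i(1)] w iw by (intro mult word_mult_closed) (simp_all add: last_X_def last_Z_def)
  qed (use XZ in \<open>simp_all add: last_X_def last_Z_def\<close>)
  moreover obtain c ps p where cps: "P = (c, ps @ [p])" "length ps = n" "c \<in> pauli_scalars"
    using P by (auto simp: words_def length_Suc_conv_rev)
  moreover have "P = word_mult (embed [] [PI] (c, ps)) (?w p)"
    using cps by simp
  moreover have "(c, ps) \<in> words n" "embed [] [PI] (c, ps) \<in> words (Suc n)"
    using cps by (simp_all add: words_def)
  ultimately show ?thesis using mult w ext by presburger
qed

lemma circ_act_embed:
  "valid_circ n gs \<Longrightarrow> P \<in> words n \<Longrightarrow> circ_act gs (embed [] [p] P) = embed [] [p] (circ_act gs P)"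
  using circ_act_extend[of "snd P" gs "fst P" "[p]"] by (auto simp: words_def embed_def)

lemma circ_act_last:
  assumes "valid_circ n gs"
  shows "circ_act gs (last_X n) = last_X n" "circ_act gs (last_Z n) = last_Z n"
  using circ_act_extend[of "replicate n PI" gs 1 "[PX]"] circ_act_extend[of "replicate n PI" gs 1 "[PZ]"]
    assms by (simp_all add: last_X_def last_Z_def circ_act_scalar)

lemma ex_normal_circ:
  "word_aut n \<Phi> \<Longrightarrow> \<exists>C. is_normal n C \<and> (\<forall>P\<in>words n. circ_act (normal_circ n C) P = \<Phi> P)"
proof (induction n arbitrary: \<Phi>)
  case 0
  have "is_normal 0 (Normal_circuit [] 0)" by (simp add: is_normal_def)
  \<comment> \<open>On zero qubits every word is a scalar, hence fixed; the phase exponent is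
    immaterial and was chosen to be 0.\<close>
  moreover have "\<Phi> P = P" if "P \<in> words 0" for P
    using word_aut_scalar[OF 0] that by (auto simp: words_def)
  ultimately show ?case
    by (intro exI[of _ "Normal_circuit [] 0"]) (auto simp: normal_circ_def)
next
  case (Suc n)
  let ?inv = "inv_into (words (Suc n))"
  obtain L M where L: "Z_normal (Suc n) L" and M: "X_normal (Suc n) M"
    and LM: "circ_act (Z_circ L @ X_circ (Suc n) M) (?inv \<Phi> (last_Z n)) = last_Z n"
      "circ_act (Z_circ L @ X_circ (Suc n) M) (?inv \<Phi> (last_X n)) = last_X n"
    using ex_layer[OF word_aut_inv[OF Suc.prems]] by blast
  define \<rho> where "\<rho> = circ_act (Z_circ L @ X_circ (Suc n) M)"
  have \<rho>: "word_aut (Suc n) \<rho>"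
    unfolding \<rho>_def using Z_circ_valid[OF L] X_circ_valid[OF M] by (intro circ_act_aut) simp
  \<comment> \<open>What remains to be realized once the first layer, whose action is
    \<open>\<rho>\<close>, has been applied.\<close>
  define \<Psi> where "\<Psi> = \<Phi> \<circ> ?inv \<rho>"
  have \<Psi>: "word_aut (Suc n) \<Psi>"
    unfolding \<Psi>_def by (intro word_aut_comp word_aut_inv Suc.prems \<rho>)
  have fix_last: "\<Psi> W = W" if "W \<in> words (Suc n)" "\<rho> (?inv \<Phi> W) = W" for W
  proof -
    \<comment> \<open>The layer was built so that \<open>\<rho>\<close> and \<open>\<Phi>\<close>
      have the same preimage of \<open>W\<close>, and so \<open>\<Psi>\<close> fixes
      \<open>W\<close>.\<close>
    have "?inv \<rho> W = ?inv \<Phi> W"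
      using word_aut_inv_into(3)[OF \<rho> word_aut_inv_into(2)[OF Suc.prems that(1)]] that(2) by simp
    then show ?thesis using word_aut_inv_into(1)[OF Suc.prems that(1)] by (simp add: \<Psi>_def)
  qed
  have X: "\<Psi> (last_X n) = last_X n" and Z: "\<Psi> (last_Z n) = last_Z n"
    using fix_last LM by (simp_all add: \<rho>_def)
  obtain \<psi> where \<psi>: "word_aut n \<psi>"
    "\<And>P. P \<in> words n \<Longrightarrow> \<Psi> (embed [] [PI] P) = embed [] [PI] (\<psi> P)"
    using restrict_aut[OF \<Psi> X Z] by blast
  obtain C where C: "is_normal n C" "\<And>P. P \<in> words n \<Longrightarrow> circ_act (normal_circ n C) P = \<psi> P"
    using Suc.IH[OF \<psi>(1)] by blast
  obtain ls p where C': "C = Normal_circuit ls p" by (cases C)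
  note v = normal_circ_valid[OF C(1)]
  have *: "circ_act (normal_circ n C) Q = \<Psi> Q" if "Q \<in> words (Suc n)" for Q
  proof (rule word_aut_eqI[OF _ \<Psi> _ _ _ that])
    show "word_aut (Suc n) (circ_act (normal_circ n C))"
      by (rule circ_act_aut[OF valid_circ_mono[OF v le_SucI[OF le_refl]]])
  qed (simp_all add: X Z circ_act_last[OF v] circ_act_embed[OF v] C(2) \<psi>(2))
  \<comment> \<open>The first layer acts by \<open>\<rho>\<close> and the rest by
    \<open>\<Psi>\<close>, whose composite is \<open>\<Phi>\<close>.\<close>
  have "circ_act (normal_circ (Suc n) (Normal_circuit ((L, M) # ls) p)) P = \<Phi> P" if "P \<in> words (Suc n)" for P
    using *[OF word_aut_closed[OF \<rho> that]] word_aut_inv_into(3)[OF \<rho> that]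
    by (simp add: normal_circ_Cons C' \<rho>_def \<Psi>_def)
  moreover have "is_normal (Suc n) (Normal_circuit ((L, M) # ls) p)"
    using L M C(1) C' is_normal_Cons by blast
  ultimately show ?case by blast
qed

text \<open>Later layers leave the last qubit alone, so the preimages of \<open>last_Z n\<close> and
  \<open>last_X n\<close> depend on the first layer only. They determine its parameters, after which
  the layer is cancelled and the induction continues. The phase exponents act trivially and are
  never compared.\<close>

lemma normal_circ_unique:
  "is_normal n C \<Longrightarrow> is_normal n C' \<Longrightarrow>
   (\<And>P. P \<in> words n \<Longrightarrow> circ_act (normal_circ n C) P = circ_act (normal_circ n C') P) \<Longrightarrow>
   layers C = layers C'"
proof (induction n arbitrary: C C')
  case 0
  then show ?case by (simp add: is_normal_def)
next
  case (Suc n)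
  from Suc.prems(1) obtain L M ls p where C: "C = Normal_circuit ((L, M) # ls) p"
    "Z_normal (Suc n) L" "X_normal (Suc n) M" "is_normal n (Normal_circuit ls p)"
    by (rule is_normal_cases)
  from Suc.prems(2) obtain L' M' ls' p' where C': "C' = Normal_circuit ((L', M') # ls') p'"
    "Z_normal (Suc n) L'" "X_normal (Suc n) M'" "is_normal n (Normal_circuit ls' p')"
    by (rule is_normal_cases)
  let ?Z = "\<lambda>L. circ_act (Z_circ L)" and ?X = "\<lambda>M. circ_act (X_circ (Suc n) M)"
  let ?R = "circ_act (normal_circ n (Normal_circuit ls p))"
    and ?R' = "circ_act (normal_circ n (Normal_circuit ls' p'))"
  have eq: "?R (?X M (?Z L P)) = ?R' (?X M' (?Z L' P))" if "P \<in> words (Suc n)" for P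
    using Suc.prems(3)[OF that] by (simp add: C(1) C'(1) normal_circ_Cons)
  note v = normal_circ_valid[OF C(4)] and v' = normal_circ_valid[OF C'(4)]
  note aut = circ_act_aut[OF Z_circ_valid[OF C(2)]] circ_act_aut[OF X_circ_valid[OF C(3)]]
    circ_act_aut[OF valid_circ_mono[OF v le_SucI[OF le_refl]]]
  note aut' = circ_act_aut[OF Z_circ_valid[OF C'(2)]] circ_act_aut[OF X_circ_valid[OF C'(3)]]
    circ_act_aut[OF valid_circ_mono[OF v' le_SucI[OF le_refl]]]
  \<comment> \<open>What follows the Z-normal part of the second circuit is injective, so outputs
    may be compared before it.\<close>
  have inj': "P = Q" if "P \<in> words (Suc n)" "Q \<in> words (Suc n)" "?R' (?X M' P) = ?R' (?X M' Q)" for P Q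
    using that word_aut_inj[OF aut'(3)] word_aut_inj[OF aut'(2)] circ_act_words by metis
  have Zw: "Z_word (Suc n) N \<in> words (Suc n)" if "Z_normal (Suc n) N" for N
    using that by (cases "Zk N") (auto simp: Z_word_def Z_normal_def words_def pauli_scalars_1)
  have Xw: "X_word M \<in> words (Suc n)"
    using C(3) by (cases "Xh M") (auto simp: X_word_def X_normal_def words_def pauli_scalars_1)
  let ?P = "Z_word (Suc n) L"
  \<comment> \<open>For each circuit, its own \<open>Z_word\<close> is the preimage of
    \<open>last_Z n\<close>; since the circuits act alike, these preimages coincide.\<close>
  have "?R' (?X M' (?Z L' ?P)) = last_Z n"
    using eq[OF Zw[OF C(2)]] Z_circ_act[OF C(2)] X_circ_act(2)[OF C(3)] circ_act_last(2)[OF v]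
    by (simp add: last_Z_def)
  also have "\<dots> = ?R' (?X M' (?Z L' (Z_word (Suc n) L')))"
    using Z_circ_act[OF C'(2)] X_circ_act(2)[OF C'(3)] circ_act_last(2)[OF v']
    by (simp add: last_Z_def)
  finally have "?Z L' ?P = ?Z L' (Z_word (Suc n) L')"
    using inj' Zw C(2) C'(2) circ_act_words by blast
  then have "?P = Z_word (Suc n) L'"
    using word_aut_inj[OF aut'(1)] Zw C(2) C'(2) by blast
  then have L: "L = L'" using Z_word_inj C(2) C'(2) by blast
  \<comment> \<open>Every word is the image of some word under the now common Z-normal circuit, so
    that circuit can be cancelled on the right.\<close>
  have eq2: "?R (?X M P) = ?R' (?X M' P)" if "P \<in> words (Suc n)" for P
    using eq[OF word_aut_inv_into(2)[OF aut(1) that]] word_aut_inv_into(1)[OF aut(1) that] by (simp add: L)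
  have Xw': "X_word M' \<in> words (Suc n)"
    using C'(3) by (cases "Xh M'") (auto simp: X_word_def X_normal_def words_def pauli_scalars_1)
  have "?R' (?X M' (X_word M)) = last_X n"
    using eq2[OF Xw] X_circ_act(1)[OF C(3)] circ_act_last(1)[OF v] by (simp add: last_X_def)
  also have "\<dots> = ?R' (?X M' (X_word M'))"
    using X_circ_act(1)[OF C'(3)] circ_act_last(1)[OF v'] by (simp add: last_X_def)
  finally have "X_word M = X_word M'" using inj' Xw Xw' by blast
  then have M: "M = M'" by (rule X_word_inj)
  have eq3: "?R P = ?R' P" if "P \<in> words (Suc n)" for P
    using eq2[OF word_aut_inv_into(2)[OF aut(2) that]] word_aut_inv_into(1)[OF aut(2) that] by (simp add: M)
  have "?R P = ?R' P" if "P \<in> words n" for P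
  proof -
    have "embed [] [PI] P \<in> words (Suc n)" using that by (auto simp: words_def)
    from eq3[OF this] have "embed [] [PI] (?R P) = embed [] [PI] (?R' P)"
      using that by (simp add: circ_act_embed[OF v] circ_act_embed[OF v'])
    then show ?thesis by (simp add: embed_def prod_eq_iff)
  qed
  then have "layers (Normal_circuit ls p) = layers (Normal_circuit ls' p')"
    by (intro Suc.IH[OF C(4) C'(4)])
  then show ?case by (simp add: C(1) C'(1) L M)
qed

theorem proposition5p5:
  fixes n :: nat and \<phi> :: "complex mat \<Rightarrow> complex mat"
  assumes "\<phi> \<in> iso (pauli_group n) (pauli_group n)"
    and "\<forall>c\<in>pauli_scalars. \<phi> (c \<cdot>\<^sub>m 1\<^sub>m (2 ^ n)) = c \<cdot>\<^sub>m 1\<^sub>m (2 ^ n)"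
  shows "(\<exists>C. is_normal n C \<and> normal_op n C \<in> Clifford n \<and>
            (\<forall>P\<in>carrier (pauli_group n). normal_op n C \<bullet>\<^sub>C P = \<phi> P)) \<and>
         (\<forall>C C'. is_normal n C \<longrightarrow> is_normal n C' \<longrightarrow>
            (\<forall>P\<in>carrier (pauli_group n). normal_op n C \<bullet>\<^sub>C P = \<phi> P) \<longrightarrow>
            (\<forall>P\<in>carrier (pauli_group n). normal_op n C' \<bullet>\<^sub>C P = \<phi> P) \<longrightarrow>
            layers C = layers C')"
proof -
  let ?G = "carrier (pauli_group n)"
  have hom: "\<And>P Q. P \<in> ?G \<Longrightarrow> Q \<in> ?G \<Longrightarrow> \<phi> (P * Q) = \<phi> P * \<phi> Q"
    and bij: "bij_betw \<phi> ?G ?G"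
    using assms(1) by (auto simp: iso_def hom_def pauli_group_def)
  have wG: "word_mat P \<in> ?G" if "P \<in> words n" for P
    using that word_mat_image by blast
  have eqI: "P = Q" if "P \<in> words n" "Q \<in> words n" "word_mat P = word_mat Q" for P Q
    using that word_mat_inj by (meson inj_onD)
  \<comment> \<open>The given automorphism transported along the bijection between words and Pauli
    operators.\<close>
  define \<Phi> where "\<Phi> = inv_into (words n) word_mat \<circ> \<phi> \<circ> word_mat"
  have bij\<Phi>: "bij_betw \<Phi> (words n) (words n)"
    unfolding \<Phi>_def using word_mat_bij bij bij_betw_inv_into[OF word_mat_bij]
    by (metis bij_betw_trans)
  then have \<Phi>w: "\<Phi> P \<in> words n" if "P \<in> words n" for P
    using that by (auto dest: bij_betwE)
  have \<Phi>: "word_mat (\<Phi> P) = \<phi> (word_mat P)" if "P \<in> words n" for P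
  proof -
    have "\<phi> (word_mat P) \<in> ?G" using bij wG[OF that] by (auto dest: bij_betwE)
    then show ?thesis
      using bij_betw_inv_into_right[OF word_mat_bij] by (simp add: \<Phi>_def)
  qed
  have "word_aut n \<Phi>"
    unfolding word_aut_def
  proof (intro conjI ballI bij\<Phi>)
    fix P Q assume PQ: "P \<in> words n" "Q \<in> words n"
    then show "\<Phi> (word_mult P Q) = word_mult (\<Phi> P) (\<Phi> Q)"
      by (intro eqI \<Phi>w word_mult_closed)
        (simp_all add: \<Phi> \<Phi>w word_mult_closed hom wG flip: word_mat_mult[of _ n])
  next
    fix c assume "c \<in> pauli_scalars"
    then show "\<Phi> (c, replicate n PI) = (c, replicate n PI)"
      using assms(2) by (intro eqI \<Phi>w word_one_in) (simp_all only: \<Phi> word_one_in word_mat_scalar)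
  qed
  then obtain C where C: "is_normal n C" "\<forall>P\<in>words n. circ_act (normal_circ n C) P = \<Phi> P"
    using ex_normal_circ by blast
  have conj: "normal_op n C \<bullet>\<^sub>C word_mat P = word_mat (circ_act (normal_circ n C) P)"
    if "is_normal n C" "P \<in> words n" for C P
    unfolding normal_op_def using that by (intro circuit_op_conj normal_circ_valid)
  have "normal_op n C \<bullet>\<^sub>C P = \<phi> P" if "P \<in> ?G" for P
  proof -
    from that obtain Q where Q: "Q \<in> words n" "P = word_mat Q" using word_mat_image by blast
    show ?thesis unfolding Q(2) conj[OF C(1) Q(1)] using C(2) \<Phi> Q(1) by simp
  qed
  moreover have "normal_op n C \<in> Clifford n"
    unfolding normal_op_def using C(1) by (intro circuit_op_Clifford normal_circ_valid)
  moreover have "layers D = layers D'"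
    if "is_normal n D" "is_normal n D'"
      "\<forall>P\<in>?G. normal_op n D \<bullet>\<^sub>C P = \<phi> P" "\<forall>P\<in>?G. normal_op n D' \<bullet>\<^sub>C P = \<phi> P" for D D'
  proof (rule normal_circ_unique[OF that(1,2)])
    fix P assume P: "P \<in> words n"
    have "word_mat (circ_act (normal_circ n D) P) = word_mat (circ_act (normal_circ n D') P)"
      using that(3,4) wG[OF P] conj[OF that(1) P] conj[OF that(2) P] by simp
    then show "circ_act (normal_circ n D) P = circ_act (normal_circ n D') P"
      by (rule eqI[OF circ_act_words[OF P] circ_act_words[OF P]])
  qed
  ultimately show ?thesis using C(1) by blast
qed

end
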